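(* Let $d\ge3$ and let $S$ be a subordinator with Laplace exponent $\phi$ such that: (1) for some $\alpha\in[0,2]$, $\displaystyle\lim_{\lambda\to+\infty}\frac{\phi'(\lambda x)}{\phi'(\lambda)}=x^{\frac{\alpha}{2}-1}$ for every $x>0$; (2) the potential measure of $S$ has a decreasing density $u$. Let $X$ be the corresponding subordinate Brownian motion in $\mathbb{R}^d$, with Green function $G(x,y)=g(|y-x|)$. If $\alpha\in[0,2)$, then $$g(r)\asymp r^{-d-2}\,\frac{\phi'(r^{-2})}{\phi(r^{-2})^2},\quad r\to0+ .$$ If $\alpha=2$, then $$g(r)\asymp r^{-d+2}\,\frac{1}{\phi'(r^{-2})}\asymp r^{-d}\,\frac{1}{\phi(r^{-2})},\quad r\to0+ .$$
   Context: A subordinator is a Lévy process $S$ in $\mathbb{R}$ with $S_0=0$ and values in $[0,\infty)$; its Laplace exponent $\phi$ is given by $\mathbb{E}e^{-\lambda S_t}=e^{-t\phi(\lambda)}$, $\lambda>0$, and has the form $\phi(\lambda)=\gamma\lambda+\int_{(0,\infty)}(1-e^{-\lambda t})\,\mu(dt)$ with $\gamma\ge0$ and Lévy measure $\mu$, $\int_{(0,\infty)}(1\wedge t)\,\mu(dt)<\infty$. The potential measure of $S$ is $U(A)=\mathbb{E}\int_0^\infty \mathbf{1}_{\{S_t\in A\}}\,dt$ for measurable $A\subset[0,\infty)$; that it has density $u$ means $U(dt)=u(t)\,dt$. "Decreasing" is meant in the non-strict sense. Let $B$ be a Brownian motion in $\mathbb{R}^d$ independent of $S$, with transition density $(4\pi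 t)^{-d/2}\exp(-|x-y|^2/(4t))$. The subordinate Brownian motion is $X_t=B(S_t)$. Its Green function $G(x,y)$ ($x\ne y$) is the density of the measure $A\mapsto\mathbb{E}_x\int_0^\infty\mathbf{1}_{\{X_t\in A\}}\,dt$, and it is given by $G(x,y)=g(|y-x|)$ with $$g(r)=\int_0^\infty(4\pi t)^{-d/2}e^{-r^2/(4t)}u(t)\,dt,\quad r>0 .$$ The notation $f(r)\asymp h(r)$, $r\to0+$, means that $f(r)/h(r)$ stays between two positive constants for all sufficiently small $r>0$. *)

theory Defs
  imports "HOL-Probability.Probability"
begin

text \<open>Processes are indexed by \<^typ>\<open>real\<close>; only their values at times in \<open>[0, \<infinity>)\<close> matter.\<close>

definition cadlag :: "(real \<Rightarrow> 'b::topological_space) \<Rightarrow> bool" where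
  "cadlag f \<longleftrightarrow> (\<forall>t\<ge>0. (f \<longlongrightarrow> f t) (at_right t)) \<and> (\<forall>t>0. \<exists>l. (f \<longlongrightarrow> l) (at_left t))"

definition levy_process ::
  "'a measure \<Rightarrow> (real \<Rightarrow> 'a \<Rightarrow> 'b::euclidean_space) \<Rightarrow> bool" where
  "levy_process M Y \<longleftrightarrow>
     prob_space M \<and>
     (\<forall>t\<ge>0. Y t \<in> borel_measurable M) \<and>
     (AE \<omega> in M. Y 0 \<omega> = 0) \<and>
     (\<forall>(\<tau>::nat \<Rightarrow> real) n. 0 \<le> \<tau> 0 \<longrightarrow> mono \<tau> \<longrightarrow>
        prob_space.indep_vars M (\<lambda>_. borel) (\<lambda>i \<omega>. Y (\<tau> (Suc i)) \<omega> - Y (\<tau> i) \<omega>) {..<n}) \<and>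
     (\<forall>s\<ge>0. \<forall>h\<ge>0. distr M borel (\<lambda>\<omega>. Y (s + h) \<omega> - Y s \<omega>) = distr M borel (Y h)) \<and>
     (AE \<omega> in M. cadlag (\<lambda>t. Y t \<omega>))"

definition subordinator :: "'a measure \<Rightarrow> (real \<Rightarrow> 'a \<Rightarrow> real) \<Rightarrow> bool" where
  "subordinator M S \<longleftrightarrow> levy_process M S \<and> (AE \<omega> in M. \<forall>t\<ge>0. 0 \<le> S t \<omega>)"

text \<open>The Levy-Khintchine form \<open>\<gamma>\<lambda> + \<integral>(1 - exp (-\<lambda>t)) \<mu>(dt)\<close> of the Laplace exponent is a
  consequence of this definition. The values of \<open>\<phi>\<close> on \<open>(-\<infinity>, 0]\<close> are irrelevant.\<close>

definition laplace_exponent ::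
  "'a measure \<Rightarrow> (real \<Rightarrow> 'a \<Rightarrow> real) \<Rightarrow> (real \<Rightarrow> real) \<Rightarrow> bool" where
  "laplace_exponent M S \<phi> \<longleftrightarrow>
     (\<forall>t\<ge>0. \<forall>l>0. (LINT \<omega>|M. exp (- l * S t \<omega>)) = exp (- t * \<phi> l))"

text \<open>For a subordinator this is its potential measure; for the process \<open>X\<close> started at \<open>x\<close> it is
  the measure whose density is \<open>G(x, \<cdot>)\<close>.\<close>

definition occupation_measure ::
  "'a measure \<Rightarrow> (real \<Rightarrow> 'a \<Rightarrow> 'b::euclidean_space) \<Rightarrow> 'b set \<Rightarrow> ennreal" where
  "occupation_measure M Y A =
     (\<integral>\<^sup>+\<omega>. (\<integral>\<^sup>+t\<in>{0..}. indicator A (Y t \<omega>) \<partial>lborel) \<partial>M)"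

definition has_occupation_density ::
  "'a measure \<Rightarrow> (real \<Rightarrow> 'a \<Rightarrow> 'b::euclidean_space) \<Rightarrow> 'b set \<Rightarrow> ('b \<Rightarrow> real) \<Rightarrow> bool" where
  "has_occupation_density M Y D f \<longleftrightarrow>
     set_borel_measurable borel D f \<and> (AE y in lborel. y \<in> D \<longrightarrow> 0 \<le> f y) \<and>
     (\<forall>A\<in>sets borel. A \<subseteq> D \<longrightarrow>
        occupation_measure M Y A = (\<integral>\<^sup>+y\<in>A. ennreal (f y) \<partial>lborel))"

text \<open>The potential measure lives on \<open>[0, \<infinity>)\<close>.\<close>

definition potential_density ::
  "'a measure \<Rightarrow> (real \<Rightarrow> 'a \<Rightarrow> real) \<Rightarrow> (real \<Rightarrow> real) \<Rightarrow> bool" where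
  "potential_density M S u \<longleftrightarrow> has_occupation_density M S {0..} u"

text \<open>This normalisation is the one with generator \<open>\<Delta>\<close> (variance \<open>2t\<close> per coordinate).\<close>

definition bm_transition_density :: "real \<Rightarrow> real ^ 'd \<Rightarrow> real ^ 'd \<Rightarrow> real" where
  "bm_transition_density t x y =
     (4 * pi * t) powr (- real CARD('d) / 2) * exp (- (norm (x - y))\<^sup>2 / (4 * t))"

text \<open>Brownian motion started at the origin. Started at \<open>x\<close>, it is the process \<open>x + B\<close>.\<close>

definition brownian_motion :: "'a measure \<Rightarrow> (real \<Rightarrow> 'a \<Rightarrow> real ^ 'd) \<Rightarrow> bool" where
  "brownian_motion M B \<longleftrightarrow>
     levy_process M B \<and>
     (\<forall>t>0. distributed M lborel (B t) (\<lambda>y. ennreal (bm_transition_density t 0 y))) \<and>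
     (AE \<omega> in M. continuous_on {0..} (\<lambda>t. B t \<omega>))"

definition process_events ::
  "'a measure \<Rightarrow> (real \<Rightarrow> 'a \<Rightarrow> 'b::topological_space) \<Rightarrow> 'a set set" where
  "process_events M Y =
     sigma_sets (space M) {Y t -` A \<inter> space M | t A. 0 \<le> t \<and> A \<in> sets borel}"

definition independent_processes ::
  "'a measure \<Rightarrow> (real \<Rightarrow> 'a \<Rightarrow> 'b::topological_space) \<Rightarrow>
     (real \<Rightarrow> 'a \<Rightarrow> 'c::topological_space) \<Rightarrow> bool" where
  "independent_processes M Y Z \<longleftrightarrow>
     prob_space.indep_set M (process_events M Y) (process_events M Z)"

definition subordinate :: "(real \<Rightarrow> 'a \<Rightarrow> 'b) \<Rightarrow> (real \<Rightarrow> 'a \<Rightarrow> real) \<Rightarrow> real \<Rightarrow> 'a \<Rightarrow> 'b" where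
  "subordinate B S t \<omega> = B (S t \<omega>) \<omega>"

definition green_function ::
  "'a measure \<Rightarrow> (real \<Rightarrow> 'a \<Rightarrow> 'b::euclidean_space) \<Rightarrow> ('b \<Rightarrow> 'b \<Rightarrow> real) \<Rightarrow> bool" where
  "green_function M X G \<longleftrightarrow> (\<forall>x. has_occupation_density M (\<lambda>t \<omega>. x + X t \<omega>) UNIV (G x))"

text \<open>The radial profile \<open>g\<close> of the Green function in dimension \<open>d\<close>, for \<open>r > 0\<close>.\<close>

definition green_profile :: "nat \<Rightarrow> (real \<Rightarrow> real) \<Rightarrow> real \<Rightarrow> real" where
  "green_profile d u r =
     (LINT t:{0<..}|lborel. (4 * pi * t) powr (- real d / 2) * exp (- r\<^sup>2 / (4 * t)) * u t)"

text \<open>Since \<open>x / 0 = 0\<close>, the lower bound also forces \<open>h r \<noteq> 0\<close> for small \<open>r > 0\<close>.\<close>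

definition comparable_at_0 :: "(real \<Rightarrow> real) \<Rightarrow> (real \<Rightarrow> real) \<Rightarrow> bool" where
  "comparable_at_0 f h \<longleftrightarrow>
     (\<exists>c>0. \<exists>C>0. \<forall>\<^sub>F r in at_right 0. c \<le> f r / h r \<and> f r / h r \<le> C)"

end

theory Submission
  imports Defs
begin

text \<open>
  The potential density satisfies \<open>\<integral> exp (-l t) u(t) dt = 1 / \<phi>(l)\<close>, hence
  \<open>\<psi>(l) := \<integral> t exp (-l t) u(t) dt = \<phi>'(l) / \<phi>(l)\<^sup>2\<close>. As \<open>u\<close> decreases, restricting the integral to
  \<open>t \<le> 1/l\<close> gives \<open>u(t) \<le> C t\<^sup>-\<^sup>2 \<psi>(1/t)\<close>. If \<open>\<psi>(x l) \<le> \<psi>(l) / 16\<close> for some fixed \<open>x\<close> and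
  all large \<open>l\<close>, then the mass of \<open>\<psi>(l)\<close> sits on an interval of length comparable to \<open>1/l\<close> away
  from \<open>0\<close>, and monotonicity gives the converse bound near \<open>0\<close>. Splitting the integral for \<open>g(r)\<close>
  at \<open>t = r\<^sup>2\<close> then yields \<open>g(r) \<asymp> r\<^sup>-\<^sup>d\<^sup>-\<^sup>2 \<psi>(r\<^sup>-\<^sup>2)\<close>. The decay of \<open>\<psi>\<close> follows from that of \<open>\<phi>'\<close>
  when \<open>\<alpha> < 2\<close>, since \<open>\<phi>\<close> increases; for \<open>\<alpha> = 2\<close> it follows from \<open>\<phi>(l) \<asymp> l \<phi>'(l)\<close>, a
  consequence of the slow variation of \<open>\<phi>'\<close>.

  For the Green function, jointly measurable modifications of the paths make Fubini available,
  and \<open>B(S\<^sub>t)\<close> is identified in law by discretising the value of \<open>S\<^sub>t\<close>, which uses only that each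
  \<open>B\<^sub>s\<close> is independent of each \<open>S\<^sub>t\<close>.
\<close>

section \<open>Decreasing potential densities\<close>

text \<open>Half of the exponential decay absorbs the factor \<open>t\<close>, because
  \<open>y \<le> exp y\<close> at \<open>y = l * t / 2\<close>. Each factor \<open>t\<close> under a
  Laplace integral is removed in this way, at the price of halving the rate.\<close>

lemma mult_exp_minus_le:
  fixes l t :: real
  assumes "l > 0"
  shows "t * exp (- l * t) \<le> (2 / l) * exp (- (l / 2) * t)"
proof -
  have "l * t / 2 \<le> exp (l * t / 2)"
    using exp_ge_add_one_self[of "l * t / 2"] by linarith
  then have "l * t / 2 * exp (- l * t) \<le> exp (l * t / 2) * exp (- l * t)"
    by (intro mult_right_mono) auto
  also have "\<dots> = exp (- (l / 2) * t)"
    by (simp flip: exp_add)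
  finally show ?thesis
    using assms by (simp add: field_simps)
qed

text \<open>A second-order Taylor remainder estimate, obtained from \<open>1 + y \<le> exp y\<close>
  at \<open>y\<close> and at \<open>- y\<close>. It provides the quadratic error when the Laplace
  transform is differentiated in \<open>phi_deriv\<close>.\<close>

lemma exp_minus_one_minus_bounds:
  fixes y :: real
  shows "0 \<le> exp y - 1 - y" "exp y - 1 - y \<le> y\<^sup>2 * exp \<bar>y\<bar>"
proof -
  show "0 \<le> exp y - 1 - y"
    using exp_ge_add_one_self[of y] by linarith
  have "(1 - y) * exp y \<le> exp (- y) * exp y"
    using exp_ge_add_one_self[of "- y"] by (intro mult_right_mono) auto
  then have *: "exp y - 1 \<le> y * exp y"
    by (simp add: algebra_simps flip: exp_add)
  then have "exp y - 1 - y \<le> y * (exp y - 1)"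
    by (simp add: algebra_simps)
  also have "\<dots> \<le> y\<^sup>2 * exp \<bar>y\<bar>"
  proof (cases "y \<ge> 0")
    case True
    then have "y * (exp y - 1) \<le> y * (y * exp y)"
      using * by (intro mult_left_mono)
    then show ?thesis using True by (simp add: power2_eq_square)
  next
    case False
    have "(- y) * (1 - exp y) \<le> (- y) * (- y)"
      using False exp_ge_add_one_self[of y] by (intro mult_left_mono) linarith+
    also have "\<dots> \<le> y\<^sup>2 * exp \<bar>y\<bar>"
      using mult_left_mono[of 1 "exp \<bar>y\<bar>" "y\<^sup>2"] by (simp add: power2_eq_square)
    finally show ?thesis by (simp add: algebra_simps)
  qed
  finally show "exp y - 1 - y \<le> y\<^sup>2 * exp \<bar>y\<bar>" .
qed

text \<open>Raise \<open>y / p \<le> exp (y / p)\<close> to the power \<open>p\<close>. This makes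
  the factor \<open>exp (- r\<^sup>2 / (4 * t))\<close> of the heat kernel beat any negative power
  of \<open>t\<close> near zero.\<close>

lemma powr_le_powr_mult_exp:
  fixes p y :: real
  assumes "p > 0" "y > 0"
  shows "y powr p \<le> p powr p * exp y"
proof -
  have "y / p \<le> exp (y / p)"
    using exp_ge_add_one_self[of "y / p"] by linarith
  then have "(y / p) powr p \<le> exp (y / p) powr p"
    using assms by (intro powr_mono2) auto
  also have "\<dots> = exp y"
    using assms by (simp add: powr_def)
  finally show ?thesis
    using assms by (simp add: powr_divide field_simps)
qed

lemma powr_tail_integral:
  fixes q r :: real
  assumes "q > 1" "r > 0"
  shows "set_integrable lborel {r..} (\<lambda>t. t powr (- q))"
    and "(LINT t:{r..}|lborel. t powr (- q)) = r powr (1 - q) / (q - 1)"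
proof -
  have lim: "((\<lambda>t::real. t powr (1 - q) / (1 - q)) \<longlongrightarrow> 0) at_top"
    using tendsto_divide_zero[OF tendsto_neg_powr[of "1 - q" "\<lambda>x. x" at_top]] assms
    by (simp add: filterlim_ident)
  have nn: "(\<integral>\<^sup>+t. ennreal (t powr (- q)) * indicator {r..} t \<partial>lborel)
      = 0 - r powr (1 - q) / (1 - q)"
  proof (rule nn_integral_FTC_atLeast)
    fix t assume "r \<le> t"
    then show "((\<lambda>t. t powr (1 - q) / (1 - q)) has_real_derivative t powr (- q)) (at t)"
      using assms by (auto intro!: derivative_eq_intros)
  qed (use lim in auto)
  then have nn': "(\<integral>\<^sup>+t. ennreal (indicator {r..} t * t powr (- q)) \<partial>lborel)
      = ennreal (r powr (1 - q) / (q - 1))"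
    using assms by (simp add: indicator_mult_ennreal mult.commute field_simps)
  have "has_bochner_integral lborel (\<lambda>t. indicator {r..} t * t powr (- q)) (r powr (1 - q) / (q - 1))"
    using assms nn' by (intro has_bochner_integral_nn_integral) auto
  then show "set_integrable lborel {r..} (\<lambda>t. t powr (- q))"
    and "(LINT t:{r..}|lborel. t powr (- q)) = r powr (1 - q) / (q - 1)"
    by (auto simp: set_integrable_def set_lebesgue_integral_def has_bochner_integral_iff)
qed

section \<open>Laplace transform and first moment of a decreasing density\<close>

text \<open>The analytic content of the problem, free of probability: a decreasing density whose
  Laplace transform is \<open>1 / \<phi>\<close>.
  \<open>decreasing_potential_of_subordinator\<close> derives these properties from the process.
  Only \<open>t > 0\<close> is considered, since \<open>u\<close> may be unbounded at zero.\<close>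

locale decreasing_potential =
  fixes u \<phi> :: "real \<Rightarrow> real"
  assumes meas: "set_borel_measurable borel {0<..} u"
    and antimono: "antimono_on {0<..} u"
    and nonneg: "t > 0 \<Longrightarrow> 0 \<le> u t"
    and laplace_integrable: "l > 0 \<Longrightarrow> set_integrable lborel {0<..} (\<lambda>t. exp (- l * t) * u t)"
    and laplace_eq: "l > 0 \<Longrightarrow> (LINT t:{0<..}|lborel. exp (- l * t) * u t) = 1 / \<phi> l"
    and phi_pos: "l > 0 \<Longrightarrow> 0 < \<phi> l"
begin

lemma decreasing: "0 < s \<Longrightarrow> s \<le> t \<Longrightarrow> u t \<le> u s"
  using antimono by (auto simp: monotone_on_def)

lemma integrable_of_le:
  assumes [measurable]: "F \<in> borel_measurable borel" and "l > 0"
    and "\<And>t. t > 0 \<Longrightarrow> \<bar>F t\<bar> \<le> C * exp (- l * t)"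
  shows "set_integrable lborel {0<..} (\<lambda>t. F t * u t)"
proof (rule set_integrable_bound)
  show "set_integrable lborel {0<..} (\<lambda>t. C * (exp (- l * t) * u t))"
    using laplace_integrable assms by auto
  have "(\<lambda>t. F t * (indicator {0<..} t *\<^sub>R u t)) \<in> borel_measurable borel"
    using meas by (intro borel_measurable_times) (auto simp: set_borel_measurable_def)
  then show "set_borel_measurable lborel {0<..} (\<lambda>t. F t * u t)"
    by (simp add: set_borel_measurable_def mult_ac)
  show "AE t in lborel. t \<in> {0<..} \<longrightarrow> norm (F t * u t) \<le> norm (C * (exp (- l * t) * u t))"
  proof (intro AE_I2 impI)
    fix t :: real assume "t \<in> {0<..}"
    then have "norm (F t * u t) \<le> C * exp (- l * t) * u t"
      using assms(3)[of t] nonneg[of t] by (auto simp: abs_mult intro!: mult_right_mono)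
    then show "norm (F t * u t) \<le> norm (C * (exp (- l * t) * u t))"
      by (simp add: mult_ac)
  qed
qed

text \<open>Minus the derivative of the Laplace transform \<open>1 / \<phi>\<close>, hence
  \<open>deriv \<phi> l / (\<phi> l)\<^sup>2\<close> by \<open>deriv_phi\<close>.\<close>

definition moment :: "real \<Rightarrow> real" where
  "moment l = (LINT t:{0<..}|lborel. t * exp (- l * t) * u t)"

lemma moment_integrable:
  assumes "l > 0"
  shows "set_integrable lborel {0<..} (\<lambda>t. t * exp (- l * t) * u t)"
  using assms mult_exp_minus_le[OF assms]
  by (intro integrable_of_le[where l = "l / 2" and C = "2 / l"]) auto

text \<open>On \<open>{a<..b}\<close> monotonicity gives \<open>u t \<ge> u b\<close>, so the
  integral dominates a rectangle. This turns integral information into pointwise upper bounds for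
  \<open>u\<close>. The interval is open on the left so that \<open>a = 0\<close> stays inside the
  domain of monotonicity.\<close>

lemma integral_ge_step:
  assumes "set_integrable lborel {0<..} (\<lambda>t. F t * u t)"
    and "\<And>t. t > 0 \<Longrightarrow> 0 \<le> F t" "\<And>t. a < t \<Longrightarrow> t \<le> b \<Longrightarrow> c \<le> F t"
    and "0 \<le> a" "a < b" "0 \<le> c"
  shows "c * (b - a) * u b \<le> (LINT t:{0<..}|lborel. F t * u t)"
proof -
  have "c * (b - a) * u b = (LINT t:{0<..}|lborel. (c * u b) * indicator {a<..b} t)"
  proof -
    have "(LINT t:{0<..}|lborel. indicator {a<..b} t) = (LINT t|lborel. indicator {a<..b} t)"
      unfolding set_lebesgue_integral_def using assms
      by (intro Bochner_Integration.integral_cong) (auto simp: indicator_def)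
    also have "\<dots> = b - a" using assms by simp
    finally show ?thesis by simp
  qed
  also have "\<dots> \<le> (LINT t:{0<..}|lborel. F t * u t)"
  proof (rule set_integral_mono)
    have "integrable lborel (indicator {a<..b} :: real \<Rightarrow> real)"
      using assms by simp
    then have "set_integrable lborel {0<..} (indicator {a<..b} :: real \<Rightarrow> real)"
      unfolding set_integrable_def by (intro integrable_mult_indicator) auto
    then show "set_integrable lborel {0<..} (\<lambda>t. (c * u b) * indicator {a<..b} t)"
      by simp
    fix t :: real assume t: "t \<in> {0<..}"
    show "c * u b * indicator {a<..b} t \<le> F t * u t"
    proof (cases "t \<in> {a<..b}")
      case True
      then have "c * u b \<le> F t * u t"
        using t assms decreasing[of t b] nonneg by (intro mult_mono) auto
      then show ?thesis using True by simp
    qed (use assms t nonneg in auto)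
  qed (fact assms)
  finally show ?thesis .
qed

lemma moment_nonneg: "0 \<le> moment l"
  unfolding moment_def set_lebesgue_integral_def
  by (intro Bochner_Integration.integral_nonneg) (auto simp: indicator_def nonneg)

text \<open>Substituting \<open>2 * t\<close> for \<open>t\<close> produces the Jacobian 2, and then
  \<open>u (2 * t) \<le> u t\<close>. It is the source of the doubling bounds
  \<open>phi_half\<close> and \<open>moment_half\<close>; the exponential bound on \<open>F\<close>
  secures integrability.\<close>

lemma dilation_le:
  assumes [measurable]: "F \<in> borel_measurable borel" and "l > 0"
    and "\<And>t. t > 0 \<Longrightarrow> 0 \<le> F t" "\<And>t. t > 0 \<Longrightarrow> F t \<le> C * exp (- l * t)"
  shows "(LINT t:{0<..}|lborel. F t * u t) \<le> 2 * (LINT t:{0<..}|lborel. F (2 * t) * u t)"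
proof -
  have eq: "indicator {0<..} (2 * t) *\<^sub>R (F (2 * t) * u (2 * t))
      = indicator {0<..} t *\<^sub>R (F (2 * t) * u (2 * t))" for t
    by (auto simp: indicator_def)
  have int: "set_integrable lborel {0<..} (\<lambda>t. F t * u t)"
    using assms by (intro integrable_of_le[where l = l and C = C]) auto
  have "(LINT t:{0<..}|lborel. F t * u t)
      = \<bar>2\<bar> *\<^sub>R (LINT t|lborel. indicator {0<..} (0 + 2 * t) *\<^sub>R (F (0 + 2 * t) * u (0 + 2 * t)))"
    unfolding set_lebesgue_integral_def by (rule lborel_integral_real_affine) auto
  also have "\<dots> = 2 * (LINT t:{0<..}|lborel. F (2 * t) * u (2 * t))"
    by (simp only: eq add_0) (simp add: set_lebesgue_integral_def)
  also have "(LINT t:{0<..}|lborel. F (2 * t) * u (2 * t)) \<le> (LINT t:{0<..}|lborel. F (2 * t) * u t)"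
  proof (rule set_integral_mono)
    have "integrable lborel (\<lambda>t. indicator {0<..} (0 + 2 * t) *\<^sub>R (F (0 + 2 * t) * u (0 + 2 * t)))"
      by (rule lborel_integrable_real_affine[of "\<lambda>t. indicator {0<..} t *\<^sub>R (F t * u t)"])
        (use int in \<open>auto simp: set_integrable_def\<close>)
    then show "set_integrable lborel {0<..} (\<lambda>t. F (2 * t) * u (2 * t))"
      unfolding add_0 eq set_integrable_def .
    have "\<bar>F (2 * t)\<bar> \<le> C * exp (- (2 * l) * t)" if "t > 0" for t
      using assms(3,4)[of "2 * t"] that by (simp add: mult_ac)
    then show "set_integrable lborel {0<..} (\<lambda>t. F (2 * t) * u t)"
      using \<open>l > 0\<close> by (intro integrable_of_le[where l = "2 * l" and C = C]) auto
    show "F (2 * t) * u (2 * t) \<le> F (2 * t) * u t" if "t \<in> {0<..}" for t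
      using assms(3)[of "2 * t"] that decreasing[of t "2 * t"] by (auto intro!: mult_left_mono)
  qed
  finally show ?thesis by simp
qed

lemma phi_half: assumes "l > 0" shows "\<phi> l \<le> 2 * \<phi> (l / 2)"
proof -
  have "1 / \<phi> (l / 2) \<le> 2 * (1 / \<phi> l)"
    using dilation_le[of "\<lambda>t. exp (- (l / 2) * t)" "l / 2" 1] assms
      laplace_eq[of l] laplace_eq[of "l / 2"] by simp
  then show ?thesis using assms phi_pos[of l] phi_pos[of "l / 2"] by (simp add: field_simps)
qed

text \<open>One factor 2 is the Jacobian in \<open>dilation_le\<close>, the other comes from the
  factor \<open>t\<close> of the integrand at \<open>2 * t\<close>.\<close>

lemma moment_half: assumes "l > 0" shows "moment (l / 2) \<le> 4 * moment l"
proof -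
  have "moment (l / 2) \<le> 2 * (LINT t:{0<..}|lborel. 2 * t * exp (- (l / 2) * (2 * t)) * u t)"
    unfolding moment_def using assms mult_exp_minus_le[of "l / 2"]
    by (intro dilation_le[where l = "l / 4" and C = "4 / l"]) auto
  also have "(LINT t:{0<..}|lborel. 2 * t * exp (- (l / 2) * (2 * t)) * u t)
      = (LINT t:{0<..}|lborel. 2 * (t * exp (- l * t) * u t))"
    by (simp add: mult_ac)
  also have "\<dots> = 2 * moment l"
    by (simp only: set_integral_mult_right moment_def)
  finally show ?thesis by simp
qed

lemma moment_antimono: assumes "0 < l" "l \<le> m" shows "moment m \<le> moment l"
  unfolding moment_def using assms nonneg
  by (intro set_integral_mono moment_integrable mult_right_mono mult_left_mono) auto

lemma phi_mono: assumes "0 < l" "l \<le> m" shows "\<phi> l \<le> \<phi> m"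
proof -
  have "1 / \<phi> m \<le> 1 / \<phi> l"
    unfolding laplace_eq[symmetric, OF assms(1)] laplace_eq[symmetric, OF less_le_trans[OF assms]]
    using assms nonneg
    by (intro set_integral_mono laplace_integrable mult_right_mono) auto
  then show ?thesis using assms phi_pos[of l] phi_pos[of m] by (simp add: field_simps)
qed

text \<open>Absorbing \<open>t\<close> moves the rate to \<open>l / 2\<close>, and
  \<open>phi_half\<close> moves it back, each with a factor 2. In terms of \<phi> this is
  \<open>l * deriv \<phi> l \<le> 4 * \<phi> l\<close>.\<close>

lemma moment_le_phi: assumes "l > 0" shows "l * moment l \<le> 4 / \<phi> l"
proof -
  have "moment l \<le> (LINT t:{0<..}|lborel. (2 / l) * (exp (- (l / 2) * t) * u t))"
    unfolding moment_def
  proof (intro set_integral_mono moment_integrable)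
    show "set_integrable lborel {0<..} (\<lambda>t. 2 / l * (exp (- (l / 2) * t) * u t))"
      using assms laplace_integrable[of "l / 2"] by (intro set_integrable_mult_right) auto
    show "t * exp (- l * t) * u t \<le> (2 / l) * (exp (- (l / 2) * t) * u t)" if "t \<in> {0<..}" for t
      using mult_right_mono[OF mult_exp_minus_le[OF assms, of t], of "u t"] that nonneg[of t]
      by (simp add: mult.assoc)
  qed fact
  also have "\<dots> = (2 / l) * (1 / \<phi> (l / 2))"
    unfolding set_integral_mult_right by (subst laplace_eq) (use assms in auto)
  finally have "l * moment l \<le> l * ((2 / l) * (1 / \<phi> (l / 2)))"
    using assms by (intro mult_left_mono) auto
  also have "\<dots> = 2 / \<phi> (l / 2)"
    using assms by simp
  also have "\<dots> \<le> 4 / \<phi> l"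
    using phi_half[OF assms] phi_pos[of l] phi_pos[of "l / 2"] assms by (simp add: field_simps)
  finally show ?thesis .
qed

text \<open>The Laplace transform \<open>L\<close> is differentiated by hand: its first-order
  expansion at \<open>l\<close> has an error of at most \<open>h\<^sup>2 * Q\<close>. The claim for
  \<phi> follows because \<phi> is \<open>1 / L\<close> near \<open>l\<close>.\<close>

lemma phi_deriv:
  assumes l: "l > 0"
  shows "(\<phi> has_real_derivative moment l * (\<phi> l)\<^sup>2) (at l)"
proof -
  define L where "L m = (LINT t:{0<..}|lborel. exp (- m * t) * u t)" for m
  define Q where "Q = (LINT t:{0<..}|lborel. t\<^sup>2 * exp (- (l / 2) * t) * u t)"
  have Qint: "set_integrable lborel {0<..} (\<lambda>t. t\<^sup>2 * exp (- (l / 2) * t) * u t)"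
  proof (rule integrable_of_le[where l = "l / 8" and C = "(4 / l) * (8 / l)"])
    fix t :: real assume t: "t > 0"
    \<comment> \<open>The two factors \<open>t\<close> are absorbed one after the other, so the rate
      drops from \<open>l / 2\<close> to \<open>l / 4\<close> and then to
      \<open>l / 8\<close>.\<close>
    have "t * (t * exp (- (l / 2) * t)) \<le> t * (2 / (l / 2) * exp (- (l / 4) * t))"
      using mult_exp_minus_le[of "l / 2" t] l t by (intro mult_left_mono) auto
    also have "\<dots> = (4 / l) * (t * exp (- (l / 4) * t))" by simp
    also have "\<dots> \<le> (4 / l) * (2 / (l / 4) * exp (- (l / 8) * t))"
      using mult_exp_minus_le[of "l / 4" t] l by (intro mult_left_mono) auto
    finally show "\<bar>t\<^sup>2 * exp (- (l / 2) * t)\<bar> \<le> (4 / l) * (8 / l) * exp (- (l / 8) * t)"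
      using t by (simp add: power2_eq_square mult_ac)
  qed (use l in auto)
  \<comment> \<open>For \<open>\<bar>h\<bar> < l / 2\<close> the growth
    \<open>exp (\<bar>h\<bar> * t)\<close> of the Taylor remainder consumes at most half of the
    decay \<open>exp (- l * t)\<close>, which leaves the integrand of \<open>Q\<close>.\<close>
  have bnd: "0 \<le> L (l + h) - L l + h * moment l \<and> L (l + h) - L l + h * moment l \<le> h\<^sup>2 * Q"
    if h: "\<bar>h\<bar> < l / 2" for h
  proof -
    let ?R = "\<lambda>t. exp (- (l + h) * t) * u t - exp (- l * t) * u t + h * (t * exp (- l * t) * u t)"
    have int: "set_integrable lborel {0<..} (\<lambda>t. exp (- (l + h) * t) * u t)"
      "set_integrable lborel {0<..} (\<lambda>t. exp (- l * t) * u t)"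
      "set_integrable lborel {0<..} (\<lambda>t. h * (t * exp (- l * t) * u t))"
      using h l moment_integrable by (intro laplace_integrable set_integrable_mult_right; simp; fail)+
    have R: "set_integrable lborel {0<..} ?R"
      by (intro int set_integral_add set_integral_diff)
    have eq: "L (l + h) - L l + h * moment l = (LINT t:{0<..}|lborel. ?R t)"
      unfolding L_def moment_def set_integral_mult_right[symmetric]
      by (subst set_integral_add(2), (intro int set_integral_diff)+, subst set_integral_diff(2),
          (intro int)+) (rule refl)
    have pt: "0 \<le> ?R t \<and> ?R t \<le> h\<^sup>2 * (t\<^sup>2 * exp (- (l / 2) * t) * u t)" if t: "t \<in> {0<..}" for t
    proof -
      have Req: "?R t = exp (- l * t) * u t * (exp (- h * t) - 1 - (- h * t))"
        by (simp add: algebra_simps flip: exp_add)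
      have "exp (- h * t) - 1 - (- h * t) \<le> (h * t)\<^sup>2 * exp (\<bar>h\<bar> * t)"
        using exp_minus_one_minus_bounds(2)[of "- h * t"] t by (simp add: abs_mult)
      also have "\<dots> \<le> (h * t)\<^sup>2 * exp (l / 2 * t)"
        using h t by (intro mult_left_mono) auto
      finally have "?R t \<le> exp (- l * t) * u t * ((h * t)\<^sup>2 * exp (l / 2 * t))"
        unfolding Req using t nonneg by (intro mult_left_mono) auto
      also have "\<dots> = h\<^sup>2 * (t\<^sup>2 * (exp (- l * t) * exp (l / 2 * t)) * u t)"
        by (simp add: power_mult_distrib mult_ac)
      also have "exp (- l * t) * exp (l / 2 * t) = exp (- (l / 2) * t)"
        by (simp flip: exp_add)
      finally have "?R t \<le> h\<^sup>2 * (t\<^sup>2 * exp (- (l / 2) * t) * u t)" .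
      moreover have "0 \<le> ?R t"
        unfolding Req using exp_minus_one_minus_bounds(1)[of "- h * t"] t nonneg[of t]
        by (intro mult_nonneg_nonneg) auto
      ultimately show ?thesis by simp
    qed
    have "0 \<le> (LINT t:{0<..}|lborel. ?R t)"
      using pt unfolding set_lebesgue_integral_def
      by (intro Bochner_Integration.integral_nonneg) (auto simp: indicator_def)
    moreover have "(LINT t:{0<..}|lborel. ?R t)
        \<le> (LINT t:{0<..}|lborel. h\<^sup>2 * (t\<^sup>2 * exp (- (l / 2) * t) * u t))"
      using pt Qint by (intro set_integral_mono R set_integrable_mult_right) auto
    ultimately show ?thesis unfolding eq Q_def by simp
  qed
  have "((\<lambda>h. (L (l + h) - L l) / h - (- moment l)) \<longlongrightarrow> 0) (at 0)"
  proof (rule Lim_null_comparison)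
    show "\<forall>\<^sub>F h in at 0. norm ((L (l + h) - L l) / h - (- moment l)) \<le> \<bar>h\<bar> * Q"
      unfolding eventually_at
    proof (intro exI[of _ "l / 2"] conjI ballI impI)
      fix h :: real assume h: "h \<noteq> 0 \<and> dist h 0 < l / 2"
      have "norm ((L (l + h) - L l) / h - (- moment l)) = \<bar>L (l + h) - L l + h * moment l\<bar> / \<bar>h\<bar>"
      proof -
        have "(L (l + h) - L l) / h - (- moment l) = (L (l + h) - L l + h * moment l) / h"
          using h by (simp add: add_divide_distrib)
        then show ?thesis by (simp only: real_norm_def abs_divide)
      qed
      also have "\<dots> \<le> h\<^sup>2 * Q / \<bar>h\<bar>"
        using bnd[of h] h by (intro divide_right_mono) auto
      also have "\<dots> = \<bar>h\<bar> * Q" using h by (simp add: power2_eq_square abs_if)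
      finally show "norm ((L (l + h) - L l) / h - (- moment l)) \<le> \<bar>h\<bar> * Q" .
    qed (use l in auto)
    show "((\<lambda>h. \<bar>h\<bar> * Q) \<longlongrightarrow> 0) (at 0)"
      by (auto intro!: tendsto_eq_intros)
  qed
  then have dL: "(L has_real_derivative - moment l) (at l)"
    unfolding DERIV_def by (rule LIM_zero_cancel)
  have L: "L m = 1 / \<phi> m" if "m > 0" for m
    using laplace_eq that by (simp add: L_def)
  have D: "((\<lambda>m. 1 / L m) has_real_derivative moment l * (\<phi> l)\<^sup>2) (at l)"
    using l phi_pos[OF l] L[OF l]
    by (auto intro!: derivative_eq_intros dL simp: power2_eq_square)
  have "\<forall>\<^sub>F m in nhds l. \<phi> m = 1 / L m"
  proof -
    have "\<forall>\<^sub>F m in nhds l. m > 0" using eventually_nhds_in_open[of "{0<..}" l] l by simp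
    then show ?thesis by eventually_elim (simp add: L)
  qed
  from iffD2[OF DERIV_cong_ev[OF refl this refl] D] show ?thesis .
qed

lemma deriv_phi: "l > 0 \<Longrightarrow> deriv \<phi> l = moment l * (\<phi> l)\<^sup>2"
  using phi_deriv DERIV_imp_deriv by blast

section \<open>Pointwise bounds of the density by its moment\<close>

text \<open>If the moment vanished, the rectangle over \<open>{t / 2<..t}\<close> would force
  \<open>u t = 0\<close> for every \<open>t > 0\<close>, and the Laplace transform would be zero
  instead of \<open>1 / \<phi> l\<close>.\<close>

lemma moment_pos: assumes "l > 0" shows "0 < moment l"
proof (rule ccontr)
  assume "\<not> 0 < moment l"
  then have 0: "moment l = 0" using moment_nonneg[of l] by simp
  have u0: "u t = 0" if "t > 0" for t
  proof -
    have "(t / 2 * exp (- l * t)) * (t - t / 2) * u t \<le> moment l"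
      unfolding moment_def using that assms moment_integrable
      by (intro integral_ge_step mult_mono) auto
    moreover have "(t / 2 * exp (- l * t)) * (t - t / 2) > 0" using that by simp
    ultimately show ?thesis
      using nonneg[OF that] 0 by (smt (verit) mult_pos_pos)
  qed
  have "(LINT t:{0<..}|lborel. exp (- l * t) * u t) = (LINT t:{0::real<..}|lborel. (0::real))"
    unfolding set_lebesgue_integral_def
    by (rule Bochner_Integration.integral_cong) (auto simp: u0 indicator_def)
  then show False using laplace_eq[OF assms] phi_pos[OF assms] by simp
qed

text \<open>At rate \<open>1 / t\<close> the weight of the moment is at least
  \<open>t / 2 * exp (- 1)\<close> on \<open>{t / 2<..t}\<close>, an interval of length
  \<open>t / 2\<close>. The constant is \<open>12 = 2 * 2 * 3\<close>, with
  \<open>exp 1 \<le> 3\<close>.\<close>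

lemma potential_le: assumes "t > 0" shows "u t \<le> 12 * (moment (1 / t) / t\<^sup>2)"
proof -
  have "(t / 2 * exp (- 1)) * (t - t / 2) * u t \<le> moment (1 / t)"
    unfolding moment_def using assms moment_integrable[of "1 / t"]
    by (intro integral_ge_step mult_mono) auto
  moreover have "1 / 3 \<le> exp (- 1 :: real)"
    using exp_le by (simp add: exp_minus field_simps)
  then have "(t / 2 * (1 / 3)) * (t - t / 2) * u t \<le> (t / 2 * exp (- 1)) * (t - t / 2) * u t"
    using assms nonneg by (intro mult_right_mono mult_left_mono) auto
  ultimately have "(t / 2 * (1 / 3)) * (t - t / 2) * u t \<le> moment (1 / t)" by linarith
  then show ?thesis using assms by (simp add: field_simps power2_eq_square)
qed

text \<open>Converse of \<open>potential_le\<close> near zero. Decay of the moment rules out that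
  most of its mass lies below \<open>1 / (x * l)\<close>, and the exponential rules out the region
  above \<open>a / l\<close>. What lies in between is at most
  \<open>(a / l)\<^sup>2 * u (1 / (x * l))\<close>, so this value of \<open>u\<close> cannot be
  small.\<close>

lemma potential_ge:
  assumes x: "x \<ge> 1" and decay: "\<forall>\<^sub>F l in at_top. moment (x * l) \<le> moment l / 16"
  shows "\<exists>c>0. \<forall>\<^sub>F t in at_right 0. c * (moment (1 / t) / t\<^sup>2) \<le> u t"
proof -
  \<comment> \<open>Chosen so that \<open>exp (- (a / 2)) = 1 / 16\<close>: beyond
    \<open>a / l\<close>, half of the exponential is worth at most that factor.\<close>
  define a :: real where "a = 2 * ln 16"
  have a: "a \<ge> 1" using ln_ge_iff[of 16 "1/2"] exp_half_le2 unfolding a_def by auto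
  have ea: "exp (- (a / 2)) = 1 / 16"
    unfolding a_def by (simp add: exp_minus)
  txt \<open>The parts of the integral below \<open>1 / (x * l)\<close> and above \<open>a / l\<close> are at most
    \<open>3 * moment (x * l)\<close> and \<open>moment (l / 2) / 16\<close>, which leaves half of \<open>moment l\<close> in between.\<close>
  have key: "moment l / 2 \<le> (a / l)\<^sup>2 * u (1 / (x * l))"
    if l: "l > 0" and dec: "moment (x * l) \<le> moment l / 16" for l
  proof -
    have xl: "x * l > 0" using x l by auto
    let ?I = "{1 / (x * l)<..a / l}"
    have le: "1 / (x * l) \<le> a / l"
      using mult_mono[of 1 a 1 x] x a l by (simp add: field_simps)
    define J where "J = (a / l) * u (1 / (x * l))"
    have J0: "0 \<le> J" unfolding J_def using a l nonneg[of "1 / (x * l)"] xl by simp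
    let ?R = "\<lambda>t. 3 * (t * exp (- (x * l) * t) * u t)
        + (J * indicator ?I t + (1 / 16) * (t * exp (- (l / 2) * t) * u t))"
    have "integrable lborel (indicator ?I :: real \<Rightarrow> real)"
      using le by simp
    then have Iint: "set_integrable lborel {0<..} (indicator ?I :: real \<Rightarrow> real)"
      unfolding set_integrable_def by (intro integrable_mult_indicator) auto
    have int: "set_integrable lborel {0<..} (\<lambda>t. 3 * (t * exp (- (x * l) * t) * u t))"
      "set_integrable lborel {0<..} (\<lambda>t. J * indicator ?I t)"
      "set_integrable lborel {0<..} (\<lambda>t. (1 / 16) * (t * exp (- (l / 2) * t) * u t))"
      using moment_integrable[of "l / 2"] moment_integrable[OF xl] l Iint
      by (intro set_integrable_mult_right; simp; fail)+
    have "moment l \<le> (LINT t:{0<..}|lborel. ?R t)"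
      unfolding moment_def
    proof (intro set_integral_mono moment_integrable set_integral_add int l)
      fix t :: real assume "t \<in> {0<..}"
      then have t: "t > 0" by simp
      have p1: "0 \<le> 3 * (t * exp (- (x * l) * t) * u t)"
        and p3: "0 \<le> (1 / 16) * (t * exp (- (l / 2) * t) * u t)"
        using t nonneg[OF t] by auto
      have p2: "0 \<le> J * indicator ?I t" using J0 by simp
      consider "t \<le> 1 / (x * l)" | "t \<in> ?I" | "t > a / l" by force
      then show "t * exp (- l * t) * u t \<le> ?R t"
      proof cases
        case 1
        have "1 = exp 1 * exp (- 1 :: real)" by (simp flip: exp_add)
        also have "\<dots> \<le> 3 * exp (- (x * l) * t)"
          using 1 xl exp_le by (intro mult_mono) (auto simp: field_simps)
        finally have "exp (- l * t) \<le> 3 * exp (- (x * l) * t)"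
          using l t by (smt (verit) exp_le_one_iff mult_neg_pos)
        then have "t * exp (- l * t) * u t \<le> t * (3 * exp (- (x * l) * t)) * u t"
          using t nonneg[OF t] by (intro mult_right_mono mult_left_mono) auto
        also have "\<dots> = 3 * (t * exp (- (x * l) * t) * u t)" by simp
        finally show ?thesis using p2 p3 by linarith
      next
        case 2
        have "t * exp (- l * t) \<le> (a / l) * 1"
          using 2 l t a by (intro mult_mono) auto
        then have "t * exp (- l * t) * u t \<le> (a / l) * 1 * u (1 / (x * l))"
          using 2 t nonneg xl a l by (intro mult_mono decreasing) auto
        then have "t * exp (- l * t) * u t \<le> J * indicator ?I t"
          using 2 by (simp add: J_def)
        then show ?thesis using p1 p3 by linarith
      next
        case 3
        then have "a / 2 \<le> l / 2 * t" using l by (simp add: field_simps)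
        then have "exp (- l * t) \<le> exp (- (a / 2)) * exp (- (l / 2) * t)"
          by (simp flip: exp_add)
        then have "exp (- l * t) \<le> 1 / 16 * exp (- (l / 2) * t)" unfolding ea .
        then have "t * exp (- l * t) * u t \<le> t * (1 / 16 * exp (- (l / 2) * t)) * u t"
          using t nonneg[OF t] by (intro mult_right_mono mult_left_mono) auto
        also have "\<dots> = (1 / 16) * (t * exp (- (l / 2) * t) * u t)" by simp
        finally show ?thesis using p1 p2 by linarith
      qed
    qed
    also have "\<dots> = 3 * moment (x * l) + (J * (LINT t:{0<..}|lborel. indicator ?I t) + (1 / 16) * moment (l / 2))"
      by (subst set_integral_add, (intro int set_integral_add)+, subst set_integral_add, (intro int)+)
        (simp only: set_integral_mult_right moment_def)
    also have "(LINT t:{0<..}|lborel. indicator ?I t) = (LINT t|lborel. (indicator ?I t :: real))"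
      unfolding set_lebesgue_integral_def
    proof (intro Bochner_Integration.integral_cong refl)
      fix t :: real
      have "0 < 1 / (x * l)" using xl by simp
      then have "t > 0" if "t \<in> ?I" using that unfolding greaterThanAtMost_iff by linarith
      then show "indicator {0<..} t *\<^sub>R indicator ?I t = (indicator ?I t :: real)"
        by (auto simp: indicator_def)
    qed
    also have "\<dots> = a / l - 1 / (x * l)" using le by simp
    finally have "moment l \<le> 3 * moment (x * l) + (J * (a / l - 1 / (x * l)) + (1 / 16) * moment (l / 2))" .
    moreover have "J * (a / l - 1 / (x * l)) \<le> J * (a / l)"
      using J0 xl by (intro mult_left_mono) auto
    \<comment> \<open>The lower part contributes at most 3/16 of \<open>moment l\<close> by
      \<open>dec\<close>, the upper part at most 4/16 by \<open>moment_half\<close>; together this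
      is below one half.\<close>
    ultimately have "moment l / 2 \<le> J * (a / l)"
      using dec moment_half[OF l] moment_nonneg[of l] by linarith
    then show ?thesis by (simp add: J_def power2_eq_square mult_ac)
  qed
  have "\<forall>\<^sub>F t in at_right 0. moment (x * (1 / (x * t))) \<le> moment (1 / (x * t)) / 16"
  proof -
    have "filterlim (\<lambda>t. inverse (x * t)) at_top (at_right 0)"
      using x by (intro filterlim_inverse_at_top tendsto_eq_intros) (auto simp: eventually_at_filter)
    then have "filterlim (\<lambda>t. 1 / (x * t)) at_top (at_right 0)"
      by (simp add: inverse_eq_divide)
    then show ?thesis using decay by (rule eventually_compose_filterlim[rotated])
  qed
  moreover have "\<forall>\<^sub>F t in at_right (0::real). t > 0"
    by (rule eventually_at_right_less)
  ultimately have "\<forall>\<^sub>F t in at_right 0. 1 / (2 * (a * x)\<^sup>2) * (moment (1 / t) / t\<^sup>2) \<le> u t"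
  proof eventually_elim
    case (elim t)
    \<comment> \<open>\<open>key\<close> is used at \<open>l = 1 / (x * t)\<close>, so that the
      point \<open>1 / (x * l)\<close> at which it evaluates \<open>u\<close> is \<open>t\<close>
      itself. As \<open>x \<ge> 1\<close>, passing to \<open>moment (1 / t)\<close> only weakens the
      bound.\<close>
    have "moment (1 / (x * t)) / 2 \<le> (a / (1 / (x * t)))\<^sup>2 * u (1 / (x * (1 / (x * t))))"
      using elim x by (intro key) auto
    moreover have "moment (1 / t) \<le> moment (1 / (x * t))"
      using elim x by (intro moment_antimono) (auto simp: field_simps)
    ultimately have "moment (1 / t) / 2 \<le> (a * x * t)\<^sup>2 * u t"
      using elim x by (simp add: mult_ac)
    then show ?case using elim x a by (simp add: field_simps power2_eq_square)
  qed
  then show ?thesis using x a by (intro exI[of _ "1 / (2 * (a * x)\<^sup>2)"]) auto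
qed

section \<open>Two-sided bounds for the Green profile\<close>

text \<open>For \<open>t < r\<^sup>2\<close> the Gaussian factor compensates the singular power and
  the kernel is at most a multiple of \<open>r powr (- real d - 2) * t\<close>, which reproduces the
  integrand of the moment at rate \<open>1 / r\<^sup>2\<close>. For \<open>t \<ge> r\<^sup>2\<close>
  the density is at most \<open>u (r\<^sup>2)\<close>, which \<open>potential_le\<close> controls,
  and the kernel is integrable because \<open>d \<ge> 3\<close> makes \<open>real d / 2\<close>
  exceed 1.\<close>

lemma green_integral:
  fixes r :: real
  assumes d: "d \<ge> 3" and r: "r > 0"
  defines "k \<equiv> \<lambda>t. (4 * pi * t) powr (- real d / 2) * exp (- r\<^sup>2 / (4 * t))"
    and "C \<equiv> 12 * (real d / 2 + 1) powr (real d / 2 + 1) + 24"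
  shows "set_integrable lborel {0<..} (\<lambda>t. k t * u t)"
    and "green_profile d u r \<le> C * (r powr (- real d - 2) * moment (1 / r\<^sup>2))"
proof -
  \<comment> \<open>One more than the power of \<open>t\<close> in the kernel, so that one factor
    \<open>t\<close> survives in \<open>near\<close>. Since \<open>2 * p = real d + 2\<close>, the
    same exponent yields the power of \<open>r\<close> in \<open>m\<close>.\<close>
  define p where "p = real d / 2 + 1"
  define m where "m = r powr (- real d - 2)"
  \<comment> \<open>The constant 4 of \<open>near\<close> becomes 12 because
    \<open>3 * exp (- (1 / r\<^sup>2) * t) \<ge> 1\<close> for \<open>t < r\<^sup>2\<close>; the
    exponential is inserted to match the moment. \<open>T\<close> dominates the part with
    \<open>t \<ge> r\<^sup>2\<close>.\<close>
  define E where "E t = 12 * p powr p * m * (t * exp (- (1 / r\<^sup>2) * t) * u t)" for t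
  define T where "T t = u (r\<^sup>2) * (indicator {r\<^sup>2..} t * t powr (- (real d / 2)))" for t
  have r2: "r\<^sup>2 > 0" using r by simp
  have d2: "real d / 2 > 1" using d by simp
  have near: "k t \<le> 4 * p powr p * m * t" if t: "t > 0" for t
  proof -
    define y where "y = r\<^sup>2 / (4 * t)"
    have y: "y > 0" using t r by (simp add: y_def)
    have "y powr p \<le> p powr p * exp y"
      using y d by (intro powr_le_powr_mult_exp) (auto simp: p_def)
    then have "exp (- y) \<le> p powr p * y powr (- p)"
      using y by (simp add: exp_minus powr_minus field_simps)
    moreover have "(4 * pi * t) powr (- real d / 2) \<le> (4 * t) powr (- real d / 2)"
      using t pi_ge_two by (intro powr_mono2') auto
    ultimately have "k t \<le> (4 * t) powr (- real d / 2) * (p powr p * y powr (- p))"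
      unfolding k_def y_def by (intro mult_mono) auto
    also have "y powr (- p) = (4 * t) powr p * m"
    proof -
      have "y powr (- p) = (4 * t / r\<^sup>2) powr p"
        using t r by (simp add: y_def powr_minus powr_divide)
      also have "\<dots> = (4 * t) powr p / (r powr 2) powr p"
        using t r by (simp add: powr_divide)
      also have "(r powr 2) powr p = r powr (real d + 2)"
        unfolding powr_powr p_def by (simp add: algebra_simps)
      also have "(4 * t) powr p / r powr (real d + 2) = (4 * t) powr p * m"
        using powr_minus_divide[of r "real d + 2"] by (simp add: m_def)
      finally show ?thesis .
    qed
    also have "(4 * t) powr (- real d / 2) * (p powr p * ((4 * t) powr p * m))
        = p powr p * m * ((4 * t) powr (- real d / 2) * (4 * t) powr p)"
      by (simp add: mult_ac)
    also have "(4 * t) powr (- real d / 2) * (4 * t) powr p = 4 * t"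
      using t by (simp add: p_def flip: powr_add)
    finally show ?thesis by (simp add: mult_ac)
  qed
  have far: "k t \<le> t powr (- (real d / 2))" if t: "t > 0" for t
  proof -
    have "(4 * pi * t) powr (- real d / 2) \<le> (1 * t) powr (- real d / 2)"
      using t pi_ge_two by (intro powr_mono2' mult_right_mono) auto
    then have "k t \<le> (1 * t) powr (- real d / 2) * 1"
      unfolding k_def using t by (intro mult_mono) auto
    then show ?thesis by simp
  qed
  have k0: "0 \<le> k t" for t by (simp add: k_def)
  have bound: "k t * u t \<le> E t + T t" if t: "t > 0" for t
  proof (cases "t \<ge> r\<^sup>2")
    case True
    have "k t * u t \<le> t powr (- (real d / 2)) * u (r\<^sup>2)"
      using far[OF t] k0 nonneg[OF t] decreasing[OF r2 True] by (intro mult_mono) auto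
    moreover have "0 \<le> E t" using t nonneg[OF t] by (auto simp: E_def m_def)
    ultimately show ?thesis using True by (simp add: T_def mult_ac)
  next
    case False
    have "1 = exp 1 * exp (- 1 :: real)" by (simp flip: exp_add)
    also have "\<dots> \<le> 3 * exp (- (1 / r\<^sup>2) * t)"
      using False r2 exp_le by (intro mult_mono) (auto simp: field_simps)
    finally have "4 * p powr p * m * t * 1 \<le> 4 * p powr p * m * t * (3 * exp (- (1 / r\<^sup>2) * t))"
      using t by (intro mult_left_mono) (auto simp: m_def)
    with near[OF t] have "k t \<le> 4 * p powr p * m * t * (3 * exp (- (1 / r\<^sup>2) * t))" by linarith
    then have "k t * u t \<le> 4 * p powr p * m * t * (3 * exp (- (1 / r\<^sup>2) * t)) * u t"
      using nonneg[OF t] by (intro mult_right_mono)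
    then show ?thesis using False by (simp add: E_def T_def mult_ac)
  qed
  have Eint: "set_integrable lborel {0<..} E"
    unfolding E_def using moment_integrable[of "1 / r\<^sup>2"] r2
    by (intro set_integrable_mult_right) auto
  have Tind: "indicator {0<..} t *\<^sub>R T t
      = u (r\<^sup>2) * (indicator {r\<^sup>2..} t *\<^sub>R t powr (- (real d / 2)))" for t
    using less_le_trans[OF r2, of t] by (auto simp: T_def indicator_def)
  have Tint: "set_integrable lborel {0<..} T"
    using powr_tail_integral(1)[OF d2 r2] unfolding set_integrable_def Tind by simp
  have ETint: "set_integrable lborel {0<..} (\<lambda>t. E t + T t)"
    by (intro set_integral_add Eint Tint)
  show kint: "set_integrable lborel {0<..} (\<lambda>t. k t * u t)"
  proof (rule set_integrable_bound[OF ETint])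
    have "(\<lambda>t. k t * (indicator {0<..} t *\<^sub>R u t)) \<in> borel_measurable borel"
      using meas unfolding k_def
      by (intro borel_measurable_times) (auto simp: set_borel_measurable_def)
    then show "set_borel_measurable lborel {0<..} (\<lambda>t. k t * u t)"
      by (simp add: set_borel_measurable_def mult_ac)
    show "AE t in lborel. t \<in> {0<..} \<longrightarrow> norm (k t * u t) \<le> norm (E t + T t)"
      using bound k0 nonneg by (intro AE_I2 impI) (fastforce simp: abs_mult)
  qed
  have "green_profile d u r = (LINT t:{0<..}|lborel. k t * u t)"
    by (simp add: green_profile_def k_def)
  also have "\<dots> \<le> (LINT t:{0<..}|lborel. E t + T t)"
    using bound by (intro set_integral_mono kint ETint) auto
  also have "\<dots> = (LINT t:{0<..}|lborel. E t) + (LINT t:{0<..}|lborel. T t)"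
    by (intro set_integral_add Eint Tint)
  also have "(LINT t:{0<..}|lborel. E t) = 12 * p powr p * m * moment (1 / r\<^sup>2)"
    unfolding E_def moment_def by (simp only: set_integral_mult_right)
  also have "(LINT t:{0<..}|lborel. T t) = u (r\<^sup>2) * ((r\<^sup>2) powr (1 - real d / 2) / (real d / 2 - 1))"
    using powr_tail_integral(2)[OF d2 r2] unfolding set_lebesgue_integral_def Tind
    by (subst integral_mult_right_zero) simp
  also have "\<dots> \<le> (12 * (moment (1 / r\<^sup>2) / (r\<^sup>2)\<^sup>2)) * ((r\<^sup>2) powr (1 - real d / 2) * 2)"
  proof (rule mult_mono)
    \<comment> \<open>For \<open>d \<ge> 3\<close> the denominator is at least 1/2. With the 12 of
      \<open>potential_le\<close> this gives the summand 24 of \<open>C\<close>.\<close>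
    have "(r\<^sup>2) powr (1 - real d / 2) / (real d / 2 - 1) \<le> (r\<^sup>2) powr (1 - real d / 2) / (1 / 2)"
      using d by (intro divide_left_mono) auto
    then show "(r\<^sup>2) powr (1 - real d / 2) / (real d / 2 - 1) \<le> (r\<^sup>2) powr (1 - real d / 2) * 2"
      by simp
  qed (use potential_le[OF r2] moment_nonneg[of "1 / r\<^sup>2"] d in auto)
  also have "\<dots> = 24 * moment (1 / r\<^sup>2) * ((r\<^sup>2) powr (1 - real d / 2) / (r\<^sup>2)\<^sup>2)"
    by simp
  also have "(r\<^sup>2) powr (1 - real d / 2) / (r\<^sup>2)\<^sup>2 = m"
  proof -
    have "(r\<^sup>2) powr (1 - real d / 2) = r powr (2 - real d)"
      using r by (simp add: powr_powr algebra_simps flip: powr_numeral)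
    moreover have "(r\<^sup>2)\<^sup>2 = r powr 4" using r by simp
    ultimately show ?thesis
      by (simp only: powr_diff[symmetric] m_def) (simp add: algebra_simps)
  qed
  finally show "green_profile d u r \<le> C * (r powr (- real d - 2) * moment (1 / r\<^sup>2))"
    by (simp add: C_def p_def m_def algebra_simps)
qed

text \<open>Only \<open>{r\<^sup>2 / 2<..r\<^sup>2}\<close> is kept. There the kernel is at least
  \<open>(4 * pi * r\<^sup>2) powr (- real d / 2) * exp (- 1 / 2)\<close> and the density at least
  \<open>u (r\<^sup>2)\<close>.\<close>

lemma green_profile_ge:
  assumes d: "d \<ge> 3" and r: "r > 0"
  shows "(4 * pi) powr (- real d / 2) * exp (- 1 / 2) / 2 * r powr (2 - real d) * u (r\<^sup>2)
    \<le> green_profile d u r"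
proof -
  let ?c = "(4 * pi * r\<^sup>2) powr (- real d / 2) * exp (- 1 / 2)"
  have r2: "r\<^sup>2 > 0" using r by simp
  have "?c * (r\<^sup>2 - r\<^sup>2 / 2) * u (r\<^sup>2) \<le> green_profile d u r"
    unfolding green_profile_def
  proof (rule integral_ge_step[OF green_integral(1)[OF d r]])
    fix t :: real assume t: "r\<^sup>2 / 2 < t" "t \<le> r\<^sup>2"
    then have t0: "t > 0" using r2 by linarith
    show "?c \<le> (4 * pi * t) powr (- real d / 2) * exp (- r\<^sup>2 / (4 * t))"
      using t t0 d by (intro mult_mono powr_mono2') (auto simp: field_simps)
  qed (use r2 in auto)
  also have "?c * (r\<^sup>2 - r\<^sup>2 / 2) * u (r\<^sup>2)
      = (4 * pi) powr (- real d / 2) * exp (- 1 / 2) / 2 * ((r\<^sup>2) powr (- real d / 2) * r\<^sup>2) * u (r\<^sup>2)"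
    using r by (simp add: powr_mult)
  also have "(r\<^sup>2) powr (- real d / 2) * r\<^sup>2 = r powr (2 - real d)"
  proof -
    have "(r\<^sup>2) powr (- real d / 2) = r powr (- real d)"
      using r by (simp add: powr_powr flip: powr_numeral)
    moreover have "r\<^sup>2 = r powr 2" using r by simp
    ultimately have "(r\<^sup>2) powr (- real d / 2) * r\<^sup>2 = r powr (- real d + 2)"
      by (simp only: powr_add)
    then show ?thesis by (simp add: algebra_simps)
  qed
  finally show ?thesis .
qed

text \<open>The decay condition enters through \<open>potential_ge\<close> at
  \<open>t = r\<^sup>2\<close>, that is, in the lower bound; the upper bound is
  \<open>green_integral\<close>, valid for every \<open>r > 0\<close>. The powers match because
  \<open>2 - d - 4 = - d - 2\<close>.\<close>

lemma green_profile_comparable: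
  assumes d: "d \<ge> 3"
    and x: "x \<ge> 1" and decay: "\<forall>\<^sub>F l in at_top. moment (x * l) \<le> moment l / 16"
  shows "comparable_at_0 (green_profile d u) (\<lambda>r. r powr (- real d - 2) * moment (r powr -2))"
proof -
  obtain c where c: "c > 0" and "\<forall>\<^sub>F t in at_right 0. c * (moment (1 / t) / t\<^sup>2) \<le> u t"
    using potential_ge[OF x decay] by blast
  moreover have "filterlim (\<lambda>r::real. r\<^sup>2) (at_right 0) (at_right 0)"
    by (auto simp: filterlim_at eventually_at_filter intro!: tendsto_eq_intros)
  ultimately have "\<forall>\<^sub>F r in at_right 0. c * (moment (1 / r\<^sup>2) / (r\<^sup>2)\<^sup>2) \<le> u (r\<^sup>2)"
    using eventually_compose_filterlim by fast
  then have low: "\<forall>\<^sub>F r in at_right 0. r > 0 \<and> c * (moment (1 / r\<^sup>2) / (r\<^sup>2)\<^sup>2) \<le> u (r\<^sup>2)"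
    using eventually_at_right_less[of "0::real"] by eventually_elim simp
  define A where "A = (4 * pi) powr (- real d / 2) * exp (- 1 / 2) / 2"
  define C where "C = 12 * (real d / 2 + 1) powr (real d / 2 + 1) + 24"
  have A: "A > 0" by (simp add: A_def)
  have C: "C > 0" by (simp add: C_def add_nonneg_pos)
  have "\<forall>\<^sub>F r in at_right 0.
      A * c \<le> green_profile d u r / (r powr (- real d - 2) * moment (r powr -2)) \<and>
      green_profile d u r / (r powr (- real d - 2) * moment (r powr -2)) \<le> C"
    using low
  proof eventually_elim
    case (elim r)
    then have r: "r > 0" and u: "c * (moment (1 / r\<^sup>2) / (r\<^sup>2)\<^sup>2) \<le> u (r\<^sup>2)" by auto
    have rm: "r powr -2 = 1 / r\<^sup>2" using r by (simp add: powr_minus_divide)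
    have pos: "r powr (- real d - 2) * moment (1 / r\<^sup>2) > 0"
      using moment_pos[of "1 / r\<^sup>2"] r by simp
    have "r powr (2 - real d) = r powr (- real d - 2) * r powr 4"
      by (simp flip: powr_add)
    also have "r powr 4 = (r\<^sup>2)\<^sup>2" using r by simp
    finally have "A * c * (r powr (- real d - 2) * moment (1 / r\<^sup>2))
        = A * r powr (2 - real d) * (c * (moment (1 / r\<^sup>2) / (r\<^sup>2)\<^sup>2))"
      using r by simp
    also have "\<dots> \<le> A * r powr (2 - real d) * u (r\<^sup>2)"
      using u A by (intro mult_left_mono) auto
    also have "\<dots> \<le> green_profile d u r"
      using green_profile_ge[OF d r] by (simp add: A_def)
    finally show ?case
      using green_integral(2)[OF d r] pos unfolding rm
      by (simp add: pos_le_divide_eq pos_divide_le_eq C_def)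
  qed
  then show ?thesis
    unfolding comparable_at_0_def using A C c by (intro exI[of _ "A * c"] exI[of _ C] conjI) auto
qed

section \<open>From the variation of \<open>deriv \<phi>\<close> to the decay of the moment\<close>

lemma deriv_phi_pos: "l > 0 \<Longrightarrow> deriv \<phi> l > 0"
  using deriv_phi moment_pos phi_pos by (metis mult_pos_pos zero_less_power)

text \<open>As \<phi> increases, \<open>moment (x * l) / moment l\<close> is at most
  \<open>deriv \<phi> (x * l) / deriv \<phi> l\<close>. This tends to \<open>x powr q\<close>, and a
  negative \<open>q\<close> allows an \<open>x\<close> with limit below 1/16.\<close>

lemma moment_decay_of_deriv_ratio:
  assumes q: "q < 0"
    and ratio: "\<And>x::real. x > 0 \<Longrightarrow> ((\<lambda>l. deriv \<phi> (l * x) / deriv \<phi> l) \<longlongrightarrow> x powr q) at_top"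
  shows "\<exists>x\<ge>1. \<forall>\<^sub>F l in at_top. moment (x * l) \<le> moment l / 16"
proof -
  have "((\<lambda>x::real. x powr q) \<longlongrightarrow> 0) at_top"
    using q by (intro tendsto_neg_powr filterlim_ident)
  then have "\<forall>\<^sub>F x::real in at_top. x powr q < 1 / 16" by (rule order_tendstoD) simp
  moreover have "\<forall>\<^sub>F x::real in at_top. x \<ge> 1" by (rule eventually_ge_at_top)
  ultimately have "\<forall>\<^sub>F x::real in at_top. x powr q < 1 / 16 \<and> x \<ge> 1" by eventually_elim simp
  then obtain x :: real where x: "x powr q < 1 / 16" "x \<ge> 1"
    by (auto dest!: eventually_happens)
  have "\<forall>\<^sub>F l in at_top. deriv \<phi> (l * x) / deriv \<phi> l < 1 / 16"
    using ratio[of x] x by (intro order_tendstoD(2)) auto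
  moreover have "\<forall>\<^sub>F l::real in at_top. l > 0" by (rule eventually_gt_at_top)
  ultimately have "\<forall>\<^sub>F l in at_top. moment (x * l) \<le> moment l / 16"
  proof eventually_elim
    case (elim l)
    have xl: "x * l > 0" "l \<le> x * l" using elim x by auto
    have "moment (x * l) * (\<phi> (x * l))\<^sup>2 \<le> moment l * (\<phi> l)\<^sup>2 / 16"
      using elim deriv_phi_pos[of l] deriv_phi[of l] deriv_phi[of "x * l"] xl
      by (simp add: field_simps)
    also have "\<dots> \<le> moment l / 16 * (\<phi> (x * l))\<^sup>2"
      using phi_mono[of l "x * l"] phi_pos[of l] elim xl moment_nonneg[of l]
      by (auto intro!: mult_left_mono power_mono)
    finally show ?case using phi_pos[of "x * l"] xl by (simp add: mult_le_cancel_right)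
  qed
  then show ?thesis using x by blast
qed

text \<open>A dyadic form of Karamata's theorem for slowly varying \<open>deriv \<phi>\<close>.
  Going from \<open>l\<close> to \<open>l / 2\<close> multiplies \<open>deriv \<phi>\<close> by at
  most 3/2, so \<open>l * deriv \<phi> l\<close> shrinks by the factor 3/4. The increments of \<phi>
  over dyadic intervals are therefore dominated by a geometric series.\<close>

lemma phi_le_deriv_of_deriv_ratio:
  assumes ratio: "((\<lambda>l. deriv \<phi> (l * (1 / 2)) / deriv \<phi> l) \<longlongrightarrow> 1) at_top"
  shows "\<exists>K>0. \<forall>\<^sub>F l in at_top. \<phi> l \<le> K * (l * deriv \<phi> l)"
proof -
  have "\<forall>\<^sub>F l in at_top. deriv \<phi> (l * (1 / 2)) / deriv \<phi> l < 3 / 2"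
    using ratio by (intro order_tendstoD(2)) auto
  then obtain L0 where L0: "\<And>l. l \<ge> L0 \<Longrightarrow> deriv \<phi> (l * (1 / 2)) / deriv \<phi> l < 3 / 2"
    by (auto simp: eventually_at_top_linorder)
  define L where "L = max 1 L0"
  have L: "L > 0" by (simp add: L_def)
  have half: "deriv \<phi> (l / 2) \<le> 3 / 2 * deriv \<phi> l" if "l \<ge> L" for l
    using L0[of l] that L deriv_phi_pos[of l] by (simp add: L_def field_simps)
  have step: "\<phi> l \<le> \<phi> (l / 2) + 4 * (l / 2 * deriv \<phi> (l / 2))" if l: "l > 0" for l
  proof -
    \<comment> \<open>The derivative at the intermediate point \<open>z\<close> is compared with the
      one at \<open>l / 2\<close>: the moment decreases, and \<phi> at most doubles, which gives the
      factor \<open>2\<^sup>2 = 4\<close>.\<close>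
    have "\<exists>z. l / 2 < z \<and> z < l \<and> \<phi> l - \<phi> (l / 2) = (l - l / 2) * (moment z * (\<phi> z)\<^sup>2)"
      using l by (intro MVT2 phi_deriv) auto
    then obtain z where z: "l / 2 < z" "z < l"
      and eq: "\<phi> l - \<phi> (l / 2) = (l - l / 2) * (moment z * (\<phi> z)\<^sup>2)" by blast
    have z0: "z > 0" using z l by linarith
    have "\<phi> z \<le> 2 * \<phi> (l / 2)"
      using phi_mono[of z l] phi_half[OF l] z z0 by linarith
    then have "(\<phi> z)\<^sup>2 \<le> (2 * \<phi> (l / 2))\<^sup>2"
      using phi_pos[OF z0] by (intro power_mono) auto
    then have "moment z * (\<phi> z)\<^sup>2 \<le> moment (l / 2) * (2 * \<phi> (l / 2))\<^sup>2"
      using moment_antimono[of "l / 2" z] z l moment_nonneg by (intro mult_mono) auto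
    also have "\<dots> = 4 * deriv \<phi> (l / 2)"
      using l by (simp add: deriv_phi power_mult_distrib)
    finally have "(l - l / 2) * (moment z * (\<phi> z)\<^sup>2) \<le> (l - l / 2) * (4 * deriv \<phi> (l / 2))"
      using l by (intro mult_left_mono) auto
    then show ?thesis using eq by simp
  qed
  \<comment> \<open>A lower bound for \<open>l * deriv \<phi> l\<close> on the starting interval
    from \<open>L\<close> to \<open>2 * L\<close>. The quotient \<open>\<phi> (2 * L) / m\<close> in
    \<open>K\<close> settles that interval.\<close>
  define m where "m = L * (moment (2 * L) * (\<phi> L)\<^sup>2)"
  have m: "m > 0" using L moment_pos[of "2 * L"] phi_pos[of L] by (simp add: m_def)
  define K where "K = max 12 (\<phi> (2 * L) / m)"
  txt \<open>The constant survives the dyadic step because \<open>(K + 4) * 3 / 4 \<le> K\<close> for \<open>K \<ge> 12\<close>.\<close>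
  have K: "\<phi> l \<le> K * (l * deriv \<phi> l)" if "L \<le> l" "l \<le> 2 ^ Suc n * L" for l n
    using that
  proof (induction n arbitrary: l)
    case 0
    then have l: "l > 0" "L \<le> l" "l \<le> 2 * L" using L by auto
    have "m \<le> l * (moment l * (\<phi> l)\<^sup>2)"
      unfolding m_def using l L moment_antimono[of l "2 * L"] phi_mono[of L l] phi_pos[of L]
        moment_nonneg
      by (intro mult_mono power_mono) auto
    then have mD: "m \<le> l * deriv \<phi> l" using l by (simp add: deriv_phi)
    have "\<phi> l \<le> \<phi> (2 * L)" using l by (intro phi_mono) auto
    also have "\<dots> = \<phi> (2 * L) / m * m" using m by simp
    also have "\<dots> \<le> K * (l * deriv \<phi> l)"
      using mD m phi_pos[of "2 * L"] L by (intro mult_mono) (auto simp: K_def)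
    finally show ?case .
  next
    case (Suc n)
    show ?case
    proof (cases "l \<le> 2 ^ Suc n * L")
      case True
      then show ?thesis using Suc.IH[of l] Suc.prems by blast
    next
      case False
      \<comment> \<open>A point above \<open>2 ^ Suc n * L\<close> has its half above
        \<open>2 ^ n * L\<close>, hence above \<open>L\<close>, so the induction hypothesis covers
        the half.\<close>
      have "L * 1 \<le> L * 2 ^ n" using L by (intro mult_left_mono) auto
      moreover have "2 * (L * 2 ^ n) < l" using False by (simp add: mult_ac)
      ultimately have "L \<le> l / 2" by linarith
      then have l2: "L \<le> l / 2" "l / 2 \<le> 2 ^ Suc n * L" "l \<ge> L" "l > 0"
        using False Suc.prems L by (auto simp: mult_ac)
      define D where "D = l * deriv \<phi> l"
      have D: "D > 0" using l2 deriv_phi_pos[of l] by (simp add: D_def)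
      have K12: "K \<ge> 12" by (simp add: K_def)
      have half': "l / 2 * deriv \<phi> (l / 2) \<le> 3 / 4 * D"
        using mult_left_mono[OF half[OF l2(3)], of "l / 2"] l2 by (simp add: D_def)
      have "\<phi> l \<le> (K + 4) * (l / 2 * deriv \<phi> (l / 2))"
        using step[OF l2(4)] Suc.IH[OF l2(1,2)] by (simp add: algebra_simps)
      also have "\<dots> \<le> (K + 4) * (3 / 4 * D)"
        using half' K12 by (intro mult_left_mono) auto
      also have "\<dots> \<le> K * D"
        using mult_right_mono[OF K12, of D] D by (simp add: algebra_simps)
      finally show ?thesis by (simp add: D_def)
    qed
  qed
  have "\<phi> l \<le> K * (l * deriv \<phi> l)" if l: "l \<ge> L" for l
  proof -
    obtain n where "l / L < 2 ^ n" using real_arch_pow[of 2 "l / L"] by auto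
    then have "l \<le> 2 ^ n * L" using L by (simp add: field_simps)
    also have "\<dots> \<le> 2 ^ Suc n * L" using L by simp
    finally show ?thesis using K l by blast
  qed
  then have "\<forall>\<^sub>F l in at_top. \<phi> l \<le> K * (l * deriv \<phi> l)"
    unfolding eventually_at_top_linorder by blast
  moreover have "K > 0" by (simp add: K_def)
  ultimately show ?thesis by blast
qed

text \<open>The hypothesis reads \<open>1 / \<phi> l \<le> K * (l * moment l)\<close>, while
  \<open>moment_le_phi\<close> bounds \<open>x * l * moment (x * l)\<close> by
  \<open>4 / \<phi> (x * l) \<le> 4 / \<phi> l\<close>. Hence
  \<open>moment (x * l) \<le> (4 * K / x) * moment l\<close>, and \<open>x \<ge> 64 * K\<close>
  gives 1/16.\<close>

lemma moment_decay_of_phi_le_deriv: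
  assumes "K > 0" and "\<forall>\<^sub>F l in at_top. \<phi> l \<le> K * (l * deriv \<phi> l)"
  shows "\<exists>x\<ge>1. \<forall>\<^sub>F l in at_top. moment (x * l) \<le> moment l / 16"
proof -
  define x where "x = max 1 (64 * K)"
  have x: "x \<ge> 1" "x \<ge> 64 * K" by (auto simp: x_def)
  have "\<forall>\<^sub>F l::real in at_top. l > 0" by (rule eventually_gt_at_top)
  with assms(2) have "\<forall>\<^sub>F l in at_top. moment (x * l) \<le> moment l / 16"
  proof eventually_elim
    case (elim l)
    have xl: "x * l > 0" "l \<le> x * l" using elim x by auto
    have p: "\<phi> l > 0" using phi_pos elim by blast
    have "\<phi> l * 1 \<le> \<phi> l * (K * (l * moment l * \<phi> l))"
      using elim by (simp add: deriv_phi power2_eq_square mult_ac)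
    then have "1 \<le> K * (l * moment l * \<phi> l)"
      using p by (simp only: mult_le_cancel_left_pos)
    then have lo: "1 / \<phi> l \<le> K * (l * moment l)"
      using p by (simp add: field_simps)
    have "64 * K * (l * moment (x * l)) \<le> x * (l * moment (x * l))"
      using x elim moment_nonneg[of "x * l"] by (intro mult_right_mono) auto
    also have "\<dots> \<le> 4 / \<phi> (x * l)" using moment_le_phi[OF xl(1)] by (simp add: mult_ac)
    also have "\<dots> \<le> 4 / \<phi> l"
      using phi_mono[OF _ xl(2)] p elim by (intro divide_left_mono) (auto intro!: mult_pos_pos less_le_trans[OF p])
    also have "\<dots> \<le> 4 * (K * (l * moment l))" using lo by simp
    finally have "(4 * K * l) * (16 * moment (x * l)) \<le> (4 * K * l) * moment l"
      by (simp add: mult_ac)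
    then show ?case
      using assms(1) elim by (subst (asm) mult_le_cancel_left_pos) auto
  qed
  then show ?thesis using x by blast
qed

end

section \<open>Calculus of comparability at zero\<close>

lemma comparable_at_0_trans:
  assumes "comparable_at_0 f g" "comparable_at_0 g h"
  shows "comparable_at_0 f h"
proof -
  obtain a A b B where pos: "a > 0" "A > 0" "b > 0" "B > 0"
    and ev: "\<forall>\<^sub>F r in at_right 0. a \<le> f r / g r \<and> f r / g r \<le> A"
      "\<forall>\<^sub>F r in at_right 0. b \<le> g r / h r \<and> g r / h r \<le> B"
    using assms unfolding comparable_at_0_def by blast
  from ev have "\<forall>\<^sub>F r in at_right 0. a * b \<le> f r / h r \<and> f r / h r \<le> A * B"
  proof eventually_elim
    case (elim r)
    \<comment> \<open>Division by zero gives 0, which the positive lower bound excludes.\<close>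
    have "g r \<noteq> 0" using elim pos by auto
    then have eq: "f r / h r = (f r / g r) * (g r / h r)" by simp
    have "a * b \<le> (f r / g r) * (g r / h r)" "(f r / g r) * (g r / h r) \<le> A * B"
      using elim pos by (intro mult_mono; linarith)+
    then show ?case unfolding eq by simp
  qed
  then show ?thesis
    unfolding comparable_at_0_def using pos
    by (intro exI[of _ "a * b"] exI[of _ "A * B"] conjI) auto
qed

lemma comparable_at_0_cong:
  assumes "\<forall>\<^sub>F r in at_right 0. g r = h r"
  shows "comparable_at_0 f g \<longleftrightarrow> comparable_at_0 f h"
proof -
  have "(\<forall>\<^sub>F r in at_right 0. c \<le> f r / g r \<and> f r / g r \<le> C)
      \<longleftrightarrow> (\<forall>\<^sub>F r in at_right 0. c \<le> f r / h r \<and> f r / h r \<le> C)" for c C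
    by (rule eventually_subst) (use assms in eventually_elim, simp)
  then show ?thesis by (simp add: comparable_at_0_def)
qed

section \<open>Asymptotics of the Green profile in terms of \<phi>\<close>

context decreasing_potential
begin

lemma filterlim_powr_minus_two: "filterlim (\<lambda>r::real. r powr -2) at_top (at_right 0)"
proof -
  have *: "filterlim (\<lambda>r::real. inverse (r\<^sup>2)) at_top (at_right 0)"
    by (intro filterlim_inverse_at_top tendsto_eq_intros) (auto simp: eventually_at_filter)
  have "\<forall>\<^sub>F r::real in at_right 0. inverse (r\<^sup>2) = r powr -2"
    using eventually_at_right_less[of "0::real"] by eventually_elim (simp add: powr_minus)
  from iffD1[OF filterlim_cong[OF refl refl this] *] show ?thesis .
qed

lemma green_profile_asymp:
  assumes "d \<ge> 3" "\<alpha> < 2"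
    and "\<And>x::real. x > 0 \<Longrightarrow>
      ((\<lambda>l. deriv \<phi> (l * x) / deriv \<phi> l) \<longlongrightarrow> x powr (\<alpha> / 2 - 1)) at_top"
  shows "comparable_at_0 (green_profile d u)
    (\<lambda>r. r powr (- real d - 2) * (deriv \<phi> (r powr -2) / (\<phi> (r powr -2))\<^sup>2))"
proof -
  have "\<exists>x\<ge>1. \<forall>\<^sub>F l in at_top. moment (x * l) \<le> moment l / 16"
    using assms by (intro moment_decay_of_deriv_ratio[of "\<alpha> / 2 - 1"]) auto
  then have "comparable_at_0 (green_profile d u) (\<lambda>r. r powr (- real d - 2) * moment (r powr -2))"
    using green_profile_comparable[OF assms(1)] by blast
  also have "?this \<longleftrightarrow> ?thesis"
  proof (rule comparable_at_0_cong)
    show "\<forall>\<^sub>F r in at_right 0. r powr (- real d - 2) * moment (r powr -2)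
        = r powr (- real d - 2) * (deriv \<phi> (r powr -2) / (\<phi> (r powr -2))\<^sup>2)"
      using eventually_at_right_less[of "0::real"]
    proof eventually_elim
      case (elim r)
      then show ?case using phi_pos[of "r powr -2"] by (simp add: deriv_phi)
    qed
  qed
  finally show ?thesis .
qed

text \<open>With \<open>l = r powr -2\<close>, everything reduces to the quotient
  \<open>l * deriv \<phi> l / \<phi> l\<close>, which stays between \<open>1 / K\<close> and 4. The
  moment form of the asymptotics divided by the first expression is its square, and the first
  expression divided by the second is its reciprocal.\<close>

lemma green_profile_asymp_two:
  assumes d: "d \<ge> 3"
    and ratio: "((\<lambda>l. deriv \<phi> (l * (1 / 2)) / deriv \<phi> l) \<longlongrightarrow> 1) at_top"
  shows "comparable_at_0 (green_profile d u)
      (\<lambda>r. r powr (- real d + 2) * (1 / deriv \<phi> (r powr -2)))" (is ?A)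
    and "comparable_at_0 (\<lambda>r. r powr (- real d + 2) * (1 / deriv \<phi> (r powr -2)))
      (\<lambda>r. r powr (- real d) * (1 / \<phi> (r powr -2)))" (is ?B)
proof -
  obtain K where K: "K > 0" and ev: "\<forall>\<^sub>F l in at_top. \<phi> l \<le> K * (l * deriv \<phi> l)"
    using phi_le_deriv_of_deriv_ratio[OF ratio] by blast
  have "\<forall>\<^sub>F r in at_right 0. \<phi> (r powr -2) \<le> K * (r powr -2 * deriv \<phi> (r powr -2))"
    using ev filterlim_powr_minus_two by (rule eventually_compose_filterlim)
  then have ev': "\<forall>\<^sub>F r in at_right 0. r > 0 \<and>
      1 / K \<le> r powr -2 * deriv \<phi> (r powr -2) / \<phi> (r powr -2) \<and>
      r powr -2 * deriv \<phi> (r powr -2) / \<phi> (r powr -2) \<le> 4"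
    using eventually_at_right_less[of "0::real"]
  proof eventually_elim
    case (elim r)
    define l where "l = r powr -2"
    have l: "l > 0" using elim by (simp add: l_def)
    have p: "\<phi> l > 0" using phi_pos l by blast
    have "l * deriv \<phi> l / \<phi> l = (l * moment l) * \<phi> l"
      using p l by (simp add: deriv_phi power2_eq_square)
    also have "\<dots> \<le> 4 / \<phi> l * \<phi> l"
      using p l by (intro mult_right_mono moment_le_phi) auto
    finally have "l * deriv \<phi> l / \<phi> l \<le> 4" using p by simp
    moreover have "1 / K \<le> l * deriv \<phi> l / \<phi> l"
      using elim p K by (simp add: l_def[symmetric] field_simps)
    ultimately show ?case using elim by (simp add: l_def)
  qed
  have "comparable_at_0 (green_profile d u) (\<lambda>r. r powr (- real d - 2) * moment (r powr -2))"
    using moment_decay_of_phi_le_deriv[OF K ev] green_profile_comparable[OF d] by blast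
  moreover have "comparable_at_0 (\<lambda>r. r powr (- real d - 2) * moment (r powr -2))
      (\<lambda>r. r powr (- real d + 2) * (1 / deriv \<phi> (r powr -2)))"
    unfolding comparable_at_0_def
  proof (intro exI conjI)
    show "\<forall>\<^sub>F r in at_right 0.
        (1 / K)\<^sup>2 \<le> r powr (- real d - 2) * moment (r powr -2) /
          (r powr (- real d + 2) * (1 / deriv \<phi> (r powr -2))) \<and>
        r powr (- real d - 2) * moment (r powr -2) /
          (r powr (- real d + 2) * (1 / deriv \<phi> (r powr -2))) \<le> 4\<^sup>2"
      using ev'
    proof eventually_elim
      case (elim r)
      define l where "l = r powr -2"
      have l: "l > 0" using elim by (simp add: l_def)
      have p: "\<phi> l > 0" using phi_pos l by blast
      have "r powr (- real d - 2) = r powr ((- real d + 2) + -2 + -2)" by simp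
      also have "\<dots> = r powr (- real d + 2) * l\<^sup>2"
        by (simp only: powr_add l_def power2_eq_square mult.assoc)
      finally have "r powr (- real d - 2) * moment l / (r powr (- real d + 2) * (1 / deriv \<phi> l))
          = l\<^sup>2 * moment l * deriv \<phi> l"
        using elim by simp
      also have "\<dots> = (l * deriv \<phi> l / \<phi> l)\<^sup>2"
        using p l by (simp add: deriv_phi power2_eq_square)
      finally have eq: "r powr (- real d - 2) * moment l / (r powr (- real d + 2) * (1 / deriv \<phi> l))
          = (l * deriv \<phi> l / \<phi> l)\<^sup>2" .
      have b: "1 / K \<le> l * deriv \<phi> l / \<phi> l" "l * deriv \<phi> l / \<phi> l \<le> 4"
        using elim by (simp_all add: l_def)
      then have "0 \<le> l * deriv \<phi> l / \<phi> l" using K order_trans[of 0 "1 / K"] by simp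
      with b show ?case
        unfolding l_def[symmetric] eq using K by (intro conjI power_mono) auto
    qed
  qed (use K in auto)
  ultimately show ?A by (rule comparable_at_0_trans)
  show ?B
    unfolding comparable_at_0_def
  proof (intro exI conjI)
    show "\<forall>\<^sub>F r in at_right 0.
        1 / 4 \<le> r powr (- real d + 2) * (1 / deriv \<phi> (r powr -2)) /
          (r powr (- real d) * (1 / \<phi> (r powr -2))) \<and>
        r powr (- real d + 2) * (1 / deriv \<phi> (r powr -2)) /
          (r powr (- real d) * (1 / \<phi> (r powr -2))) \<le> K"
      using ev'
    proof eventually_elim
      case (elim r)
      define l where "l = r powr -2"
      have l: "l > 0" using elim by (simp add: l_def)
      have p: "\<phi> l > 0" "deriv \<phi> l > 0" using phi_pos deriv_phi_pos l by auto
      have "r powr (- real d) = r powr (- real d + 2) * l"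
        using elim by (simp add: l_def flip: powr_add)
      then have "r powr (- real d + 2) * (1 / deriv \<phi> l) / (r powr (- real d) * (1 / \<phi> l))
          = 1 / (l * deriv \<phi> l / \<phi> l)"
        using elim p l by simp
      moreover define v where "v = l * deriv \<phi> l / \<phi> l"
      moreover have "v > 0" "1 / K \<le> v" "v \<le> 4"
        using elim p l by (simp_all add: v_def l_def)
      then have "1 / 4 \<le> 1 / v" "1 / v \<le> K"
        using K by (simp_all add: field_simps)
      ultimately show ?case unfolding l_def[symmetric] by simp
    qed
  qed (use K in auto)
qed

end

section \<open>Independent composition of processes\<close>

text \<open>For \<open>t \<ge> 0\<close>, \<open>grid_point n (grid_index n t)\<close> is the first
  point strictly above \<open>t\<close> of the grid with mesh \<open>1 / real (Suc n)\<close>. The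
  shift by one in \<open>grid_point\<close> makes the inequality strict, as convergence in
  \<open>at_right t\<close> demands; \<open>Suc n\<close> avoids mesh \<open>1 / 0\<close>.\<close>

definition grid_index :: "nat \<Rightarrow> real \<Rightarrow> nat" where
  "grid_index n t = nat \<lfloor>real (Suc n) * t\<rfloor>"

definition grid_point :: "nat \<Rightarrow> nat \<Rightarrow> real" where
  "grid_point n k = (real k + 1) / real (Suc n)"

lemma grid_point_nonneg: "0 \<le> grid_point n k"
  by (simp add: grid_point_def)

lemma measurable_grid_index [measurable]: "grid_index n \<in> measurable borel (count_space UNIV)"
  unfolding grid_index_def by measurable

lemma filterlim_grid_point:
  assumes "t \<ge> 0"
  shows "filterlim (\<lambda>n. grid_point n (grid_index n t)) (at_right t) sequentially"
proof -
  have b: "t < grid_point n (grid_index n t)" "grid_point n (grid_index n t) \<le> t + 1 / real (Suc n)" for n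
  proof -
    have eq: "real (grid_index n t) = of_int \<lfloor>real (Suc n) * t\<rfloor>"
      using assms unfolding grid_index_def by (intro of_nat_nat) auto
    have fl: "real_of_int \<lfloor>real (Suc n) * t\<rfloor> \<le> t * real (Suc n)"
      "t * real (Suc n) < real_of_int \<lfloor>real (Suc n) * t\<rfloor> + 1"
      using floor_correct[of "real (Suc n) * t"] by (simp_all only: mult.commute of_int_add of_int_1)
    show "t < grid_point n (grid_index n t)"
      unfolding grid_point_def eq using fl(2) by (subst pos_less_divide_eq) auto
    show "grid_point n (grid_index n t) \<le> t + 1 / real (Suc n)"
      unfolding grid_point_def eq add_divide_distrib
      using fl(1) by (intro add_right_mono) (subst pos_divide_le_eq, auto)
  qed
  have lim: "(\<lambda>n. t + 1 / real (Suc n)) \<longlonglongrightarrow> t"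
    using tendsto_add[OF tendsto_const[of t] LIMSEQ_Suc[OF lim_1_over_n[where 'a = real]]]
    by (simp only: add_0_right)
  have "(\<lambda>n. grid_point n (grid_index n t)) \<longlonglongrightarrow> t"
  proof (rule tendsto_sandwich[OF _ _ tendsto_const lim])
    show "\<forall>\<^sub>F n in sequentially. t \<le> grid_point n (grid_index n t)"
      using less_imp_le[OF b(1)] by (intro always_eventually allI)
    show "\<forall>\<^sub>F n in sequentially. grid_point n (grid_index n t) \<le> t + 1 / real (Suc n)"
      using b(2) by (intro always_eventually allI)
  qed
  moreover have "\<forall>\<^sub>F n in sequentially. grid_point n (grid_index n t) \<in> {t<..}"
    using b(1) by (intro always_eventually allI) (simp only: greaterThan_iff)
  moreover have "\<forall>\<^sub>F n in sequentially. grid_point n (grid_index n t) \<noteq> t"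
    using b(1) by (intro always_eventually allI less_imp_neq[symmetric])
  ultimately show ?thesis
    unfolding filterlim_at by (auto elim: eventually_elim2)
qed

text \<open>Joint measurability in time and outcome is what Fubini needs. A right-continuous path is
  the pointwise limit of its values at grid points to the right, and these approximations are
  jointly measurable because they run through countably many times.\<close>

lemma levy_process_modification:
  fixes Y :: "real \<Rightarrow> 'a \<Rightarrow> 'b::euclidean_space"
  assumes "levy_process M Y"
  obtains Y' where "(\<lambda>(t, \<omega>). Y' t \<omega>) \<in> borel_measurable (borel \<Otimes>\<^sub>M M)"
    and "AE \<omega> in M. \<forall>t\<ge>0. Y' t \<omega> = Y t \<omega>"
    and "\<And>t \<omega>. t \<ge> 0 \<Longrightarrow> ((\<lambda>s. Y' s \<omega>) \<longlongrightarrow> Y' t \<omega>) (at_right t)"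
proof -
  have "AE \<omega> in M. cadlag (\<lambda>t. Y t \<omega>)"
    and [measurable]: "\<And>t. t \<ge> 0 \<Longrightarrow> Y t \<in> borel_measurable M"
    using assms by (auto simp: levy_process_def)
  then obtain N where N: "{\<omega> \<in> space M. \<not> cadlag (\<lambda>t. Y t \<omega>)} \<subseteq> N" "emeasure M N = 0" "N \<in> sets M"
    by (auto elim!: AE_E)
  have [measurable]: "N \<in> sets M" by fact
  \<comment> \<open>Paths in the null set \<open>N\<close> are replaced by 0, so that right
    continuity holds for every outcome. \<open>max 0 t\<close> restricts to the times at which
    \<open>Y\<close> is known to be measurable.\<close>
  define Y' where "Y' t \<omega> = (if \<omega> \<in> space M - N then Y (max 0 t) \<omega> else 0)" for t \<omega>
  have mx: "Y' (max 0 t) \<omega> = Y' t \<omega>" for t \<omega>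
    by (simp add: Y'_def)
  have rc: "((\<lambda>s. Y' s \<omega>) \<longlongrightarrow> Y' t \<omega>) (at_right t)" if t: "t \<ge> 0" for t \<omega>
  proof (cases "\<omega> \<in> space M - N")
    case True
    then have "cadlag (\<lambda>t. Y t \<omega>)" using N by blast
    then have "((\<lambda>s. Y s \<omega>) \<longlongrightarrow> Y t \<omega>) (at_right t)" using t by (simp add: cadlag_def)
    moreover have ev: "\<forall>\<^sub>F s in at_right t. Y s \<omega> = Y' s \<omega>"
      using eventually_at_right_less[of t] by eventually_elim (use t True in \<open>simp add: Y'_def max_def\<close>)
    moreover have "Y t \<omega> = Y' t \<omega>" using t True by (simp add: Y'_def)
    ultimately show ?thesis by (simp only: tendsto_cong[OF ev])
  next
    case False
    then have "Y' s \<omega> = 0" for s by (simp only: Y'_def if_False)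
    then show ?thesis by simp
  qed
  have [measurable]: "Y' t \<in> borel_measurable M" for t
    unfolding Y'_def by measurable
  have "(\<lambda>x. Y' (fst x) (snd x)) \<in> borel_measurable (borel \<Otimes>\<^sub>M M)"
  proof (rule borel_measurable_LIMSEQ_metric)
    fix n
    show "(\<lambda>x. Y' (grid_point n (grid_index n (max 0 (fst x)))) (snd x)) \<in> borel_measurable (borel \<Otimes>\<^sub>M M)"
      by (rule measurable_compose_countable[where f = "\<lambda>k x. Y' (grid_point n k) (snd x)"]) measurable
  next
    fix x :: "real \<times> 'a"
    have "(\<lambda>n. Y' (grid_point n (grid_index n (max 0 (fst x)))) (snd x)) \<longlonglongrightarrow> Y' (max 0 (fst x)) (snd x)"
      by (rule filterlim_compose[OF rc filterlim_grid_point]) auto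
    then show "(\<lambda>n. Y' (grid_point n (grid_index n (max 0 (fst x)))) (snd x)) \<longlonglongrightarrow> Y' (fst x) (snd x)"
      by (simp only: mx)
  qed
  moreover have "AE \<omega> in M. \<omega> \<notin> N" using N by (intro AE_not_in) auto
  then have "AE \<omega> in M. \<forall>t\<ge>0. Y' t \<omega> = Y t \<omega>"
    by (rule AE_mp) (auto intro!: AE_I2 simp: Y'_def)
  ultimately show thesis
    using that rc by (simp add: case_prod_unfold)
qed

section \<open>Laws of composed processes\<close>

text \<open>The indicator of a closed set \<open>C\<close> is the limit of the continuous functions
  \<open>max 0 (1 - real k * infdist x C)\<close>, and the closed sets form an intersection-stable
  generator of the Borel sets.\<close>

lemma measure_eqI_bounded_continuous:
  fixes \<mu> \<nu> :: "'b::metric_space measure"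
  assumes "finite_measure \<mu>" "finite_measure \<nu>"
    and s [measurable_cong]: "sets \<mu> = sets borel" "sets \<nu> = sets borel"
    and eq: "\<And>f :: 'b \<Rightarrow> real. continuous_on UNIV f \<Longrightarrow> (\<And>x. \<bar>f x\<bar> \<le> 1) \<Longrightarrow>
      (LINT x|\<mu>. f x) = (LINT x|\<nu>. f x)"
  shows "\<mu> = \<nu>"
proof -
  interpret \<mu>: finite_measure \<mu> by fact
  interpret \<nu>: finite_measure \<nu> by fact
  have closed_eq: "measure \<mu> C = measure \<nu> C" if C: "closed C" for C
  \<comment> \<open>The distance to the empty set is 0 by convention, so the approximating functions
    would be constantly 1 there.\<close>
  proof (cases "C = {}")
    case False
    define f where "f k x = max 0 (1 - real k * infdist x C)" for k x
    have f: "continuous_on UNIV (f k)" "\<bar>f k x\<bar> \<le> 1" for k x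
      unfolding f_def by (auto intro!: continuous_intros simp: infdist_nonneg)
    have [measurable]: "f k \<in> borel_measurable borel" for k
      using f(1) by (rule borel_measurable_continuous_onI)
    have [measurable]: "C \<in> sets borel" using C by simp
    have lim: "(\<lambda>k. f k x) \<longlonglongrightarrow> indicator C x" for x
    proof (cases "x \<in> C")
      case True
      then show ?thesis by (simp add: f_def)
    next
      case out: False
      then have pos: "infdist x C > 0"
        using C False by (simp add: in_closed_iff_infdist_zero less_le infdist_nonneg)
      obtain K where K: "1 / infdist x C < real K" using reals_Archimedean2 by blast
      have "f k x = 0" if "k \<ge> K" for k
      proof -
        have "1 < real K * infdist x C" using K pos by (simp add: field_simps)
        also have "\<dots> \<le> real k * infdist x C" using that pos by simp
        finally show ?thesis by (simp add: f_def)
      qed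
      then have "\<forall>\<^sub>F k in sequentially. f k x = 0"
        unfolding eventually_sequentially by blast
      then show ?thesis using out by (simp add: tendsto_eventually)
    qed
    have lim1: "(\<lambda>k. LINT x|\<mu>. f k x) \<longlonglongrightarrow> (LINT x|\<mu>. indicator C x)"
      by (rule integral_dominated_convergence[where w = "\<lambda>_. 1"]) (use lim f in auto)
    have lim2: "(\<lambda>k. LINT x|\<nu>. f k x) \<longlonglongrightarrow> (LINT x|\<nu>. indicator C x)"
      by (rule integral_dominated_convergence[where w = "\<lambda>_. 1"]) (use lim f in auto)
    have int_eq: "(LINT x|\<mu>. f k x) = (LINT x|\<nu>. f k x)" for k
      using f by (intro eq)
    from LIMSEQ_unique[OF lim1[unfolded int_eq] lim2]
    have "(LINT x|\<mu>. indicator C x) = (LINT x|\<nu>. indicator C x :: real)" .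
    then show ?thesis
      using sets_eq_imp_space_eq[OF s(1)] sets_eq_imp_space_eq[OF s(2)] by simp
  qed simp
  show ?thesis
  proof (rule measure_eqI_generator_eq[where E = "Collect closed" and \<Omega> = UNIV and A = "\<lambda>_. UNIV"])
    show "Int_stable (Collect closed :: 'b set set)" by (auto simp: Int_stable_def)
    show "sets \<mu> = sigma_sets UNIV (Collect closed)" "sets \<nu> = sigma_sets UNIV (Collect closed)"
      using s by (simp_all add: borel_eq_closed)
    show "emeasure \<mu> X = emeasure \<nu> X" if "X \<in> Collect closed" for X
      using closed_eq[of X] that by (simp add: \<mu>.emeasure_eq_measure \<nu>.emeasure_eq_measure)
  qed auto
qed

text \<open>The right-hand side evaluates \<open>Z\<close> on an independent copy of the space, so
  that \<open>T\<close> can be frozen by Fubini. If \<open>T\<close> is rounded up to the grid, the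
  event splits over countably many deterministic times, and at each of them \<open>indep\<close>
  applies. Right continuity of \<open>Z\<close> removes the rounding.\<close>

lemma (in prob_space) distr_composition_independent:
  fixes Z :: "real \<Rightarrow> 'a \<Rightarrow> 'b::euclidean_space" and T :: "'a \<Rightarrow> real"
  assumes Z [measurable]: "(\<lambda>(t, \<omega>). Z t \<omega>) \<in> borel_measurable (borel \<Otimes>\<^sub>M M)"
    and T [measurable]: "T \<in> borel_measurable M" and T0: "\<And>\<omega>. 0 \<le> T \<omega>"
    and rc: "\<And>t \<omega>. t \<ge> 0 \<Longrightarrow> ((\<lambda>s. Z s \<omega>) \<longlongrightarrow> Z t \<omega>) (at_right t)"
    and indep: "\<And>s A C. s \<ge> 0 \<Longrightarrow> A \<in> sets borel \<Longrightarrow> C \<in> sets borel \<Longrightarrow>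
      prob {\<omega> \<in> space M. Z s \<omega> \<in> A \<and> T \<omega> \<in> C}
        = prob {\<omega> \<in> space M. Z s \<omega> \<in> A} * prob {\<omega> \<in> space M. T \<omega> \<in> C}"
  shows "distr M borel (\<lambda>\<omega>. Z (T \<omega>) \<omega>) = distr (M \<Otimes>\<^sub>M M) borel (\<lambda>x. Z (T (fst x)) (snd x))"
proof -
  interpret P: pair_prob_space M M ..
  have Zc: "(\<lambda>x. Z (f x) (g x)) \<in> borel_measurable N"
    if "f \<in> borel_measurable N" "g \<in> measurable N M" for f g and N :: "'c measure"
    using measurable_compose[OF measurable_Pair[OF that] Z] by simp
  let ?q = "\<lambda>n t. grid_point n (grid_index n t)"
  have q [measurable]: "?q n \<in> borel_measurable borel" for n
    by (rule measurable_compose[OF measurable_grid_index]) simp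
  have [measurable]: "Z s \<in> borel_measurable M" for s
    by (rule Zc) simp_all
  have [measurable]: "(\<lambda>\<omega>. Z (?q n (T \<omega>)) \<omega>) \<in> borel_measurable M"
    "(\<lambda>\<omega>. Z (T \<omega>) \<omega>) \<in> borel_measurable M"
    "(\<lambda>x. Z (?q n (T (fst x))) (snd x)) \<in> borel_measurable (M \<Otimes>\<^sub>M M)"
    "(\<lambda>x. Z (T (fst x)) (snd x)) \<in> borel_measurable (M \<Otimes>\<^sub>M M)" for n
    by (rule Zc; measurable)+
  have discrete: "distr M borel (\<lambda>\<omega>. Z (?q n (T \<omega>)) \<omega>)
      = distr (M \<Otimes>\<^sub>M M) borel (\<lambda>x. Z (?q n (T (fst x))) (snd x))" for n
  proof (rule measure_eqI)
    fix A assume "A \<in> sets (distr M borel (\<lambda>\<omega>. Z (?q n (T \<omega>)) \<omega>))"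
    then have A [measurable]: "A \<in> sets borel" by simp
    have Im [measurable]: "(\<lambda>\<omega>. indicator {k} (grid_index n (T \<omega>)) :: ennreal) \<in> borel_measurable M" for k
      by (rule measurable_compose[OF measurable_compose[OF T measurable_grid_index]]) simp
    let ?I = "\<lambda>k \<omega>. indicator {k} (grid_index n (T \<omega>)) :: ennreal"
    \<comment> \<open>Only the term with \<open>k = grid_index n (T \<omega>)\<close> is nonzero.
      The outcomes of \<open>T\<close> and \<open>Z\<close> are separate variables, so both sides of
      \<open>discrete\<close> expand by the same series.\<close>
    have split: "indicator A (Z (?q n (T \<omega>)) \<omega>') = (\<Sum>k. ?I k \<omega> * indicator A (Z (grid_point n k) \<omega>'))"
      for \<omega> \<omega>'
      by (subst suminf_finite[of "{grid_index n (T \<omega>)}"]) auto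
    have ind: "(\<integral>\<^sup>+\<omega>. ?I k \<omega> * indicator A (Z (grid_point n k) \<omega>) \<partial>M)
        = (\<integral>\<^sup>+\<omega>. ?I k \<omega> \<partial>M) * (\<integral>\<^sup>+\<omega>. indicator A (Z (grid_point n k) \<omega>) \<partial>M)" for k
    proof -
      let ?C = "grid_index n -` {k}"
      have C: "?C \<in> sets borel"
        using measurable_sets[OF measurable_grid_index, of "{k}" n] by simp
      have "(\<integral>\<^sup>+\<omega>. ?I k \<omega> * indicator A (Z (grid_point n k) \<omega>) \<partial>M)
          = (\<integral>\<^sup>+\<omega>. indicator {\<omega> \<in> space M. Z (grid_point n k) \<omega> \<in> A \<and> T \<omega> \<in> ?C} \<omega> \<partial>M)"
        by (intro nn_integral_cong) (auto simp: indicator_def)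
      also have "\<dots> = ennreal (prob {\<omega> \<in> space M. Z (grid_point n k) \<omega> \<in> A \<and> T \<omega> \<in> ?C})"
        using C by (subst nn_integral_indicator) (auto simp: emeasure_eq_measure)
      also have "\<dots> = ennreal (prob {\<omega> \<in> space M. T \<omega> \<in> ?C})
          * ennreal (prob {\<omega> \<in> space M. Z (grid_point n k) \<omega> \<in> A})"
        using indep[OF grid_point_nonneg A C] by (simp add: ennreal_mult' mult.commute)
      also have "ennreal (prob {\<omega> \<in> space M. T \<omega> \<in> ?C})
          = (\<integral>\<^sup>+\<omega>. indicator {\<omega> \<in> space M. T \<omega> \<in> ?C} \<omega> \<partial>M)"
        using C by (subst nn_integral_indicator) (auto simp: emeasure_eq_measure)
      also have "\<dots> = (\<integral>\<^sup>+\<omega>. ?I k \<omega> \<partial>M)"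
        by (intro nn_integral_cong) (auto simp: indicator_def)
      also have "ennreal (prob {\<omega> \<in> space M. Z (grid_point n k) \<omega> \<in> A})
          = (\<integral>\<^sup>+\<omega>. indicator {\<omega> \<in> space M. Z (grid_point n k) \<omega> \<in> A} \<omega> \<partial>M)"
        by (subst nn_integral_indicator) (auto simp: emeasure_eq_measure)
      also have "\<dots> = (\<integral>\<^sup>+\<omega>. indicator A (Z (grid_point n k) \<omega>) \<partial>M)"
        by (intro nn_integral_cong) (auto simp: indicator_def)
      finally show ?thesis .
    qed
    have "emeasure (distr M borel (\<lambda>\<omega>. Z (?q n (T \<omega>)) \<omega>)) A
        = (\<integral>\<^sup>+\<omega>. indicator A (Z (?q n (T \<omega>)) \<omega>) \<partial>M)"
      by (subst nn_integral_indicator[symmetric], simp, subst nn_integral_distr) simp_all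
    also have "\<dots> = (\<integral>\<^sup>+\<omega>. (\<Sum>k. ?I k \<omega> * indicator A (Z (grid_point n k) \<omega>)) \<partial>M)"
      by (simp only: split)
    also have "\<dots> = (\<Sum>k. (\<integral>\<^sup>+\<omega>. ?I k \<omega> * indicator A (Z (grid_point n k) \<omega>) \<partial>M))"
      by (rule nn_integral_suminf) measurable
    also have "\<dots> = (\<Sum>k. (\<integral>\<^sup>+\<omega>. ?I k \<omega> * (\<integral>\<^sup>+\<omega>'. indicator A (Z (grid_point n k) \<omega>') \<partial>M) \<partial>M))"
      by (intro suminf_cong) (simp only: ind, subst nn_integral_multc, measurable)
    also have "\<dots> = (\<integral>\<^sup>+\<omega>. (\<Sum>k. ?I k \<omega> * (\<integral>\<^sup>+\<omega>'. indicator A (Z (grid_point n k) \<omega>') \<partial>M)) \<partial>M)"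
      by (rule nn_integral_suminf[symmetric]) measurable
    also have "\<dots> = (\<integral>\<^sup>+\<omega>. (\<integral>\<^sup>+\<omega>'. (\<Sum>k. ?I k \<omega> * indicator A (Z (grid_point n k) \<omega>')) \<partial>M) \<partial>M)"
      by (subst nn_integral_suminf, measurable, subst nn_integral_cmult, measurable)
    also have "\<dots> = (\<integral>\<^sup>+\<omega>. (\<integral>\<^sup>+\<omega>'. indicator A (Z (?q n (T \<omega>)) \<omega>') \<partial>M) \<partial>M)"
      by (simp only: split)
    also have "\<dots> = (\<integral>\<^sup>+x. indicator A (Z (?q n (T (fst x))) (snd x)) \<partial>(M \<Otimes>\<^sub>M M))"
      by (subst nn_integral_fst[symmetric]) simp_all
    also have "\<dots> = emeasure (distr (M \<Otimes>\<^sub>M M) borel (\<lambda>x. Z (?q n (T (fst x))) (snd x))) A"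
      by (subst nn_integral_indicator[symmetric], simp, subst nn_integral_distr) simp_all
    finally show "emeasure (distr M borel (\<lambda>\<omega>. Z (?q n (T \<omega>)) \<omega>)) A
      = emeasure (distr (M \<Otimes>\<^sub>M M) borel (\<lambda>x. Z (?q n (T (fst x))) (snd x))) A" .
  qed simp
  have lim: "(\<lambda>n. Z (?q n (T \<omega>)) \<omega>') \<longlonglongrightarrow> Z (T \<omega>) \<omega>'" for \<omega> \<omega>'
    by (rule filterlim_compose[OF rc filterlim_grid_point]) (simp_all add: T0)
  show ?thesis
  \<comment> \<open>Pointwise convergence passes through continuous test functions but not through
    indicators of Borel sets, so the limit laws are compared on the former.\<close>
  proof (rule measure_eqI_bounded_continuous)
    show "finite_measure (distr M borel (\<lambda>\<omega>. Z (T \<omega>) \<omega>))"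
      by (intro finite_measure_distr) simp
    show "finite_measure (distr (M \<Otimes>\<^sub>M M) borel (\<lambda>x. Z (T (fst x)) (snd x)))"
      by (intro P.P.finite_measure_distr) simp
    fix f :: "'b \<Rightarrow> real" assume cont: "continuous_on UNIV f" and f1: "\<And>x. \<bar>f x\<bar> \<le> 1"
    have [measurable]: "f \<in> borel_measurable borel"
      using cont by (rule borel_measurable_continuous_onI)
    have flim: "(\<lambda>n. f (Z (?q n (T \<omega>)) \<omega>')) \<longlonglongrightarrow> f (Z (T \<omega>) \<omega>')" for \<omega> \<omega>'
      by (rule continuous_on_tendsto_compose[OF cont lim]) auto
    have lim1: "(\<lambda>n. LINT \<omega>|M. f (Z (?q n (T \<omega>)) \<omega>)) \<longlonglongrightarrow> (LINT \<omega>|M. f (Z (T \<omega>) \<omega>))"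
      by (rule integral_dominated_convergence[where w = "\<lambda>_. 1"]) (use flim f1 in auto)
    have lim2: "(\<lambda>n. LINT x|(M \<Otimes>\<^sub>M M). f (Z (?q n (T (fst x))) (snd x)))
        \<longlonglongrightarrow> (LINT x|(M \<Otimes>\<^sub>M M). f (Z (T (fst x)) (snd x)))"
      by (rule integral_dominated_convergence[where w = "\<lambda>_. 1"]) (use flim f1 in auto)
    have eq: "(LINT \<omega>|M. f (Z (?q n (T \<omega>)) \<omega>))
        = (LINT x|(M \<Otimes>\<^sub>M M). f (Z (?q n (T (fst x))) (snd x)))" for n
    proof -
      have "(LINT \<omega>|M. f (Z (?q n (T \<omega>)) \<omega>)) = (LINT y|distr M borel (\<lambda>\<omega>. Z (?q n (T \<omega>)) \<omega>). f y)"
        by (subst integral_distr) simp_all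
      also have "\<dots> = (LINT x|(M \<Otimes>\<^sub>M M). f (Z (?q n (T (fst x))) (snd x)))"
        unfolding discrete by (subst integral_distr) simp_all
      finally show ?thesis .
    qed
    from LIMSEQ_unique[OF lim1[unfolded eq] lim2]
    have "(LINT \<omega>|M. f (Z (T \<omega>) \<omega>)) = (LINT x|(M \<Otimes>\<^sub>M M). f (Z (T (fst x)) (snd x)))" .
    then show "(LINT x|distr M borel (\<lambda>\<omega>. Z (T \<omega>) \<omega>). f x)
        = (LINT x|distr (M \<Otimes>\<^sub>M M) borel (\<lambda>x. Z (T (fst x)) (snd x)). f x)"
      by (simp add: integral_distr)
  qed simp_all
qed

section \<open>Occupation measures\<close>

text \<open>Outside one null set the two paths agree at all times \<open>t \<ge> 0\<close>, so the
  time integral is unchanged; joint measurability of \<open>Y'\<close> then permits exchanging time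
  and expectation.\<close>

lemma (in prob_space) occupation_measure_eq:
  fixes Y Y' :: "real \<Rightarrow> 'a \<Rightarrow> 'b::euclidean_space"
  assumes Y' [measurable]: "(\<lambda>(t, \<omega>). Y' t \<omega>) \<in> borel_measurable (borel \<Otimes>\<^sub>M M)"
    and eq: "AE \<omega> in M. \<forall>t\<ge>0. Y' t \<omega> = Y t \<omega>" and A [measurable]: "A \<in> sets borel"
  shows "occupation_measure M Y A = (\<integral>\<^sup>+t\<in>{0..}. (\<integral>\<^sup>+\<omega>. indicator A (Y' t \<omega>) \<partial>M) \<partial>lborel)"
proof -
  interpret P: pair_sigma_finite lborel M ..
  have m [measurable]: "(\<lambda>x. Y' (fst x) (snd x)) \<in> borel_measurable (lborel \<Otimes>\<^sub>M M)"
    using Y' by (simp add: case_prod_unfold cong: measurable_cong_sets)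
  have "(\<lambda>\<omega>. Y' t \<omega>) \<in> borel_measurable M" for t
    using measurable_compose[OF measurable_Pair1' Y', of t] by simp
  then have [measurable]: "(\<lambda>\<omega>. indicator A (Y' t \<omega>) :: ennreal) \<in> borel_measurable M" for t
    by (rule measurable_compose) simp
  have "occupation_measure M Y A
      = (\<integral>\<^sup>+\<omega>. (\<integral>\<^sup>+t. indicator A (Y' t \<omega>) * indicator {0..} t \<partial>lborel) \<partial>M)"
    unfolding occupation_measure_def
  proof (rule nn_integral_cong_AE, use eq in eventually_elim)
    case (elim \<omega>)
    then show ?case by (intro nn_integral_cong) (auto simp: indicator_def)
  qed
  also have "\<dots> = (\<integral>\<^sup>+t. (\<integral>\<^sup>+\<omega>. indicator A (Y' t \<omega>) * indicator {0..} t \<partial>M) \<partial>lborel)"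
    using P.Fubini[of "\<lambda>x. indicator A (Y' (fst x) (snd x)) * indicator {0..} (fst x)"] by simp
  also have "\<dots> = (\<integral>\<^sup>+t\<in>{0..}. (\<integral>\<^sup>+\<omega>. indicator A (Y' t \<omega>) \<partial>M) \<partial>lborel)"
    by (intro nn_integral_cong nn_integral_multc) measurable
  finally show ?thesis .
qed

text \<open>The potential measure is realised as the image \<open>V\<close> of Lebesgue measure on
  \<open>{0..}\<close> times \<open>M\<close> under \<open>S'\<close>. Agreement with the density
  \<open>u\<close> on Borel sets extends to nonnegative functions because both are measures.\<close>

lemma (in prob_space) nn_integral_potential:
  fixes S S' u :: "real \<Rightarrow> _"
  assumes S': "(\<lambda>(t, \<omega>). S' t \<omega>) \<in> borel_measurable (borel \<Otimes>\<^sub>M M)"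
    and S'0: "\<And>t \<omega>. 0 \<le> S' t \<omega>"
    and eq: "AE \<omega> in M. \<forall>t\<ge>0. S' t \<omega> = S t \<omega>"
    and pot: "potential_density M S u"
    and f [measurable]: "f \<in> borel_measurable borel"
  shows "(\<integral>\<^sup>+t\<in>{0..}. (\<integral>\<^sup>+\<omega>. f (S' t \<omega>) \<partial>M) \<partial>lborel)
    = (\<integral>\<^sup>+s. ennreal (indicator {0<..} s * u s) * f s \<partial>lborel)"
proof -
  have m [measurable]: "(\<lambda>x. S' (fst x) (snd x)) \<in> borel_measurable (lborel \<Otimes>\<^sub>M M)"
    using S' by (simp add: case_prod_unfold cong: measurable_cong_sets)
  have "(\<lambda>\<omega>. S' t \<omega>) \<in> borel_measurable M" for t
    using measurable_compose[OF measurable_Pair1' S', of t] by simp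
  note St = measurable_compose[OF this]
  have pot': "set_borel_measurable borel {0..} u"
    "\<And>A. A \<in> sets borel \<Longrightarrow> A \<subseteq> {0..} \<Longrightarrow>
      occupation_measure M S A = (\<integral>\<^sup>+y\<in>A. ennreal (u y) \<partial>lborel)"
    using pot by (simp_all add: potential_density_def has_occupation_density_def)
  have "(\<lambda>s. indicator {0<..} s * (indicator {0..} s *\<^sub>R u s)) \<in> borel_measurable borel"
    using pot'(1) by (intro borel_measurable_times) (simp_all add: set_borel_measurable_def)
  moreover have "indicator {0<..} s * (indicator {0..} s *\<^sub>R u s) = indicator {0<..} s * u s" for s
    by (simp add: indicator_def)
  ultimately have um [measurable]: "(\<lambda>s. indicator {0<..} s * u s) \<in> borel_measurable borel"
    by (simp only:)
  define V where "V = distr (density (lborel \<Otimes>\<^sub>M M) (\<lambda>x. indicator {0..} (fst x))) borel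
    (\<lambda>x. S' (fst x) (snd x))"
  define \<nu> where "\<nu> = density lborel (\<lambda>s. ennreal (indicator {0<..} s * u s))"
  have V: "(\<integral>\<^sup>+s. h s \<partial>V) = (\<integral>\<^sup>+t\<in>{0..}. (\<integral>\<^sup>+\<omega>. h (S' t \<omega>) \<partial>M) \<partial>lborel)"
    if h [measurable]: "h \<in> borel_measurable borel" for h :: "real \<Rightarrow> ennreal"
  proof -
    have "(\<integral>\<^sup>+s. h s \<partial>V)
        = (\<integral>\<^sup>+x. indicator {0..} (fst x) * h (S' (fst x) (snd x)) \<partial>(lborel \<Otimes>\<^sub>M M))"
      unfolding V_def by (subst nn_integral_distr, measurable) (simp add: nn_integral_density)
    also have "\<dots> = (\<integral>\<^sup>+t. (\<integral>\<^sup>+\<omega>. indicator {0..} t * h (S' t \<omega>) \<partial>M) \<partial>lborel)"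
      by (subst nn_integral_fst[symmetric]) simp_all
    also have "\<dots> = (\<integral>\<^sup>+t\<in>{0..}. (\<integral>\<^sup>+\<omega>. h (S' t \<omega>) \<partial>M) \<partial>lborel)"
      by (intro nn_integral_cong) (subst nn_integral_cmult, rule St, simp_all add: mult.commute)
    finally show ?thesis .
  qed
  have "V = \<nu>"
  proof (rule measure_eqI)
    show "sets V = sets \<nu>" by (simp add: V_def \<nu>_def)
    fix A assume "A \<in> sets V"
    then have A [measurable]: "A \<in> sets borel" by (simp add: V_def)
    have "emeasure V A = (\<integral>\<^sup>+s. indicator A s \<partial>V)"
      using \<open>A \<in> sets V\<close> by simp
    also have "\<dots> = (\<integral>\<^sup>+t\<in>{0..}. (\<integral>\<^sup>+\<omega>. indicator A (S' t \<omega>) \<partial>M) \<partial>lborel)"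
      by (rule V) simp
    \<comment> \<open>\<open>potential_density\<close> speaks of subsets of \<open>{0..}\<close>
      only; \<open>S'\<close> never leaves this set.\<close>
    also have "\<dots> = (\<integral>\<^sup>+t\<in>{0..}. (\<integral>\<^sup>+\<omega>. indicator (A \<inter> {0..}) (S' t \<omega>) \<partial>M) \<partial>lborel)"
      using S'0 by (simp add: indicator_def)
    also have "\<dots> = occupation_measure M S (A \<inter> {0..})"
      by (rule occupation_measure_eq[OF S' eq, symmetric]) simp
    also have "\<dots> = (\<integral>\<^sup>+y\<in>A \<inter> {0..}. ennreal (u y) \<partial>lborel)"
      by (rule pot'(2)) auto
    also have "\<dots> = (\<integral>\<^sup>+y. ennreal (indicator {0<..} y * u y) * indicator A y \<partial>lborel)"
    proof (rule nn_integral_cong_AE)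
      \<comment> \<open>The origin is Lebesgue null, which allows passing from \<open>{0..}\<close>
        to \<open>{0<..}\<close>, where monotonicity of \<open>u\<close> is available.\<close>
      have "AE y in lborel. y \<noteq> (0::real)" by (rule AE_lborel_singleton)
      then show "AE y in lborel. ennreal (u y) * indicator (A \<inter> {0..}) y
          = ennreal (indicator {0<..} y * u y) * indicator A y"
        by eventually_elim (auto simp: indicator_def)
    qed
    also have "\<dots> = emeasure \<nu> A"
      unfolding \<nu>_def by (subst emeasure_density) simp_all
    finally show "emeasure V A = emeasure \<nu> A" .
  qed
  then have "(\<integral>\<^sup>+t\<in>{0..}. (\<integral>\<^sup>+\<omega>. f (S' t \<omega>) \<partial>M) \<partial>lborel) = (\<integral>\<^sup>+s. f s \<partial>\<nu>)"
    using V[OF f] by simp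
  also have "\<dots> = (\<integral>\<^sup>+s. ennreal (indicator {0<..} s * u s) * f s \<partial>lborel)"
    unfolding \<nu>_def by (subst nn_integral_density) simp_all
  finally show ?thesis .
qed

lemma nn_integral_exp_decay:
  fixes c :: real
  assumes "c > 0"
  shows "(\<integral>\<^sup>+t\<in>{0..}. ennreal (exp (- t * c)) \<partial>lborel) = ennreal (1 / c)"
proof -
  have "LIM t at_top. c * t :> at_top"
    by (rule filterlim_tendsto_pos_mult_at_top[OF tendsto_const assms filterlim_ident])
  then have "LIM t at_top. - (c * t) :> at_bot"
    by (simp only: filterlim_uminus_at_top)
  then have "((\<lambda>t. exp (- (c * t))) \<longlongrightarrow> 0) at_top"
    by (rule filterlim_compose[OF exp_at_bot])
  from tendsto_divide_zero[OF tendsto_minus[OF this, unfolded minus_zero], of c]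
  have "(\<integral>\<^sup>+t. ennreal (exp (- (c * t))) * indicator {0..} t \<partial>lborel) = 0 - (- exp (- (c * 0)) / c)"
    using assms by (intro nn_integral_FTC_atLeast) (auto intro!: derivative_eq_intros)
  then show ?thesis by (simp add: mult.commute)
qed

section \<open>From the subordinator to its potential density\<close>

lemma subordinator_modification:
  assumes "subordinator M S"
  obtains S' where "(\<lambda>(t, \<omega>). S' t \<omega>) \<in> borel_measurable (borel \<Otimes>\<^sub>M M)"
    and "\<And>t \<omega>. 0 \<le> S' t \<omega>" and "AE \<omega> in M. \<forall>t\<ge>0. S' t \<omega> = S t \<omega>"
proof -
  have S: "levy_process M S" "AE \<omega> in M. \<forall>t\<ge>0. 0 \<le> S t \<omega>"
    using assms by (simp_all add: subordinator_def)
  obtain Y where Y: "(\<lambda>(t, \<omega>). Y t \<omega>) \<in> borel_measurable (borel \<Otimes>\<^sub>M M)"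
      "AE \<omega> in M. \<forall>t\<ge>0. Y t \<omega> = S t \<omega>"
    by (rule levy_process_modification[OF S(1)], rule that)
  show thesis
  \<comment> \<open>The absolute value makes the paths nonnegative for every outcome and changes
    nothing almost surely.\<close>
  proof (rule that[of "\<lambda>t \<omega>. \<bar>Y t \<omega>\<bar>"])
    show "(\<lambda>(t, \<omega>). \<bar>Y t \<omega>\<bar>) \<in> borel_measurable (borel \<Otimes>\<^sub>M M)"
      using borel_measurable_abs[OF Y(1)] by (simp add: case_prod_unfold)
    show "AE \<omega> in M. \<forall>t\<ge>0. \<bar>Y t \<omega>\<bar> = S t \<omega>"
      using S(2) Y(2) by eventually_elim auto
  qed simp
qed

text \<open>Integrating the expectation of \<open>exp (- l * S' t \<omega>)\<close>, which is
  \<open>exp (- t * \<phi> l)\<close>, over \<open>t \<ge> 0\<close> gives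
  \<open>1 / \<phi> l\<close>; by \<open>nn_integral_potential\<close> the same integral is the
  Laplace transform of \<open>u\<close>.\<close>

lemma (in prob_space) decreasing_potential_of_subordinator:
  assumes sub: "subordinator M S" and lap: "laplace_exponent M S \<phi>"
    and pot: "potential_density M S u" and anti: "antimono_on {0<..} u"
  shows "decreasing_potential u \<phi>"
proof -
  obtain S' where S': "(\<lambda>(t, \<omega>). S' t \<omega>) \<in> borel_measurable (borel \<Otimes>\<^sub>M M)"
      "\<And>t \<omega>. 0 \<le> S' t \<omega>" "AE \<omega> in M. \<forall>t\<ge>0. S' t \<omega> = S t \<omega>"
    by (rule subordinator_modification[OF sub], rule that)
  have St [measurable]: "(\<lambda>\<omega>. S' t \<omega>) \<in> borel_measurable M" for t
    using measurable_compose[OF measurable_Pair1' S'(1), of t] by simp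
  note potential = nn_integral_potential[OF S' pot]
  have pot': "set_borel_measurable borel {0..} u" "AE y in lborel. y \<in> {0..} \<longrightarrow> 0 \<le> u y"
    using pot by (simp_all add: potential_density_def has_occupation_density_def)
  have "(\<lambda>s. indicator {0<..} s * (indicator {0..} s *\<^sub>R u s)) \<in> borel_measurable borel"
    using pot'(1) by (intro borel_measurable_times) (simp_all add: set_borel_measurable_def)
  moreover have "indicator {0<..} s * (indicator {0..} s *\<^sub>R u s) = indicator {0<..} s * u s" for s
    by (simp add: indicator_def)
  ultimately have um [measurable]: "(\<lambda>s. indicator {0<..} s * u s) \<in> borel_measurable borel"
    by (simp only:)
  \<comment> \<open>The density is nonnegative only almost everywhere. A negative value at
    \<open>t\<close> would persist on \<open>{t<..<t + 1}\<close> by monotonicity, and this interval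
    has positive measure.\<close>
  have nonneg: "0 \<le> u t" if t: "t > 0" for t
  proof (rule ccontr)
    assume neg: "\<not> 0 \<le> u t"
    have "u s < 0" if "s \<in> {t<..<t + 1}" for s
      using monotone_onD[OF anti, of t s] that t neg by simp
    then have "AE s in lborel. s \<notin> {t<..<t + 1}"
      using pot'(2) t by (auto elim!: eventually_mono simp: not_le[symmetric])
    then have "emeasure lborel {s \<in> space lborel. s \<in> {t<..<t + 1}} = 0"
      by (rule emeasure_eq_0_AE)
    moreover have "{s \<in> space lborel. s \<in> {t<..<t + 1}} = {t<..<t + 1}" by auto
    ultimately show False using emeasure_lborel_Ioo[of t "t + 1"] by simp
  qed
  have lap': "(\<integral>\<^sup>+\<omega>. ennreal (exp (- l * S' t \<omega>)) \<partial>M) = ennreal (exp (- t * \<phi> l))"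
    and lap_int: "integrable M (\<lambda>\<omega>. exp (- l * S' t \<omega>))"
    if "t \<ge> 0" "l > 0" for t l
  proof -
    show int: "integrable M (\<lambda>\<omega>. exp (- l * S' t \<omega>))"
      using that S'(2) by (intro integrable_const_bound[where B = 1]) auto
    have "(LINT \<omega>|M. exp (- l * S' t \<omega>)) = (LINT \<omega>|M. exp (- l * S t \<omega>))"
    proof (rule integral_cong_AE)
      show "AE \<omega> in M. exp (- l * S' t \<omega>) = exp (- l * S t \<omega>)"
        using S'(3) by eventually_elim (use that in simp)
      have "S t \<in> borel_measurable M"
        using sub that by (simp add: subordinator_def levy_process_def)
      then show "(\<lambda>\<omega>. exp (- l * S t \<omega>)) \<in> borel_measurable M" by measurable
    qed measurable
    also have "\<dots> = exp (- t * \<phi> l)" using lap that by (simp add: laplace_exponent_def)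
    finally show "(\<integral>\<^sup>+\<omega>. ennreal (exp (- l * S' t \<omega>)) \<partial>M) = ennreal (exp (- t * \<phi> l))"
      by (subst nn_integral_eq_integral[OF int]) auto
  qed
  \<comment> \<open>If \<open>\<phi> l \<le> 0\<close>, then
    \<open>exp (- l * S' t \<omega>)\<close> has mean at least 1 although it is at most 1, so
    \<open>S' t\<close> is almost surely 0 at each \<open>t\<close>. The potential measure would
    then have infinite mass at 0, which a measure with a density cannot have.\<close>
  have phi_pos: "\<phi> l > 0" if l: "l > 0" for l
  proof (rule ccontr)
    assume "\<not> \<phi> l > 0"
    have AE0: "AE \<omega> in M. S' t \<omega> = 0" if t: "t \<ge> 0" for t
    proof -
      have "0 \<le> - t * \<phi> l" using t \<open>\<not> \<phi> l > 0\<close> by (simp add: mult_nonneg_nonpos)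
      then have ge: "1 \<le> exp (- t * \<phi> l)" by simp
      have "(LINT \<omega>|M. exp (- l * S' t \<omega>)) = exp (- t * \<phi> l)"
        using lap'[OF t l] by (subst (asm) nn_integral_eq_integral[OF lap_int[OF t l]]) auto
      moreover have int: "integrable M (\<lambda>\<omega>. 1 - exp (- l * S' t \<omega>))"
        using lap_int[OF t l] by simp
      moreover have "(LINT \<omega>|M. 1 - exp (- l * S' t \<omega>)) = 1 - (LINT \<omega>|M. exp (- l * S' t \<omega>))"
        using lap_int[OF t l] by (simp add: prob_space)
      ultimately have "(LINT \<omega>|M. 1 - exp (- l * S' t \<omega>)) \<le> 0" using ge by simp
      moreover have pos: "AE \<omega> in M. 0 \<le> 1 - exp (- l * S' t \<omega>)"
        using l S'(2) by (intro AE_I2) simp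
      ultimately have "(LINT \<omega>|M. 1 - exp (- l * S' t \<omega>)) = 0"
        using integral_nonneg_AE[OF pos] by simp
      then have "AE \<omega> in M. 1 - exp (- l * S' t \<omega>) = 0"
        using integral_nonneg_eq_0_iff_AE[OF int pos] by simp
      then show ?thesis by eventually_elim (use l in simp)
    qed
    have one: "(\<integral>\<^sup>+\<omega>. indicator {0::real} (S' t \<omega>) \<partial>M) = 1" if "t \<ge> 0" for t
    proof -
      have "(\<integral>\<^sup>+\<omega>. indicator {0::real} (S' t \<omega>) \<partial>M) = (\<integral>\<^sup>+\<omega>. 1 \<partial>M)"
        using AE0[OF that] by (intro nn_integral_cong_AE) (auto elim!: eventually_mono)
      then show ?thesis by (simp add: emeasure_space_1)
    qed
    have "(\<integral>\<^sup>+t\<in>{0..}. (\<integral>\<^sup>+\<omega>. indicator {0::real} (S' t \<omega>) \<partial>M) \<partial>lborel)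
        = (\<integral>\<^sup>+t. indicator {0::real..} t \<partial>lborel)"
    proof (intro nn_integral_cong)
      fix t :: real
      show "(\<integral>\<^sup>+\<omega>. indicator {0::real} (S' t \<omega>) \<partial>M) * indicator {0..} t = indicator {0..} t"
        by (cases "t \<ge> 0") (simp_all only: one, simp_all)
    qed
    also have "\<dots> = emeasure lborel {0::real..}" by simp
    also have "(\<integral>\<^sup>+t\<in>{0..}. (\<integral>\<^sup>+\<omega>. indicator {0::real} (S' t \<omega>) \<partial>M) \<partial>lborel)
        = (\<integral>\<^sup>+s. ennreal (indicator {0<..} s * u s) * indicator {0} s \<partial>lborel)"
      by (rule potential) simp
    also have "(\<lambda>s. ennreal (indicator {0<..} s * u s) * indicator {0} s) = (\<lambda>s. 0)"
      by (auto simp: indicator_def)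
    finally have "emeasure lborel {0::real..} = 0" by simp
    moreover have "emeasure lborel {0..1::real} \<le> emeasure lborel {0::real..}"
      by (rule emeasure_mono) auto
    ultimately show False by simp
  qed
  have bochner: "has_bochner_integral lborel (\<lambda>s. indicator {0<..} s *\<^sub>R (exp (- l * s) * u s)) (1 / \<phi> l)"
    if l: "l > 0" for l
  proof (rule has_bochner_integral_nn_integral)
    have "(\<lambda>s. exp (- l * s) * (indicator {0<..} s * u s)) \<in> borel_measurable borel"
      by measurable
    then show "(\<lambda>s. indicator {0<..} s *\<^sub>R (exp (- l * s) * u s)) \<in> borel_measurable lborel"
      by (simp add: mult_ac)
    show "AE s in lborel. 0 \<le> indicator {0<..} s *\<^sub>R (exp (- l * s) * u s)"
      using nonneg by (intro AE_I2) (simp add: indicator_def)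
    show "0 \<le> 1 / \<phi> l" using phi_pos[OF l] by simp
    have "(\<integral>\<^sup>+s. ennreal (indicator {0<..} s *\<^sub>R (exp (- l * s) * u s)) \<partial>lborel)
        = (\<integral>\<^sup>+s. ennreal (indicator {0<..} s * u s) * ennreal (exp (- l * s)) \<partial>lborel)"
      using nonneg by (intro nn_integral_cong) (auto simp: indicator_def ennreal_mult' mult.commute)
    also have "\<dots> = (\<integral>\<^sup>+t\<in>{0..}. (\<integral>\<^sup>+\<omega>. ennreal (exp (- l * S' t \<omega>)) \<partial>M) \<partial>lborel)"
      by (rule potential[symmetric]) measurable
    also have "\<dots> = (\<integral>\<^sup>+t\<in>{0..}. ennreal (exp (- t * \<phi> l)) \<partial>lborel)"
      by (intro nn_integral_cong) (use lap'[OF _ l] in \<open>simp add: indicator_def\<close>)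
    also have "\<dots> = ennreal (1 / \<phi> l)"
      using phi_pos[OF l] by (rule nn_integral_exp_decay)
    finally show "(\<integral>\<^sup>+s. ennreal (indicator {0<..} s *\<^sub>R (exp (- l * s) * u s)) \<partial>lborel) = ennreal (1 / \<phi> l)" .
  qed
  show ?thesis
  proof
    show "set_borel_measurable borel {0<..} u"
      using um by (simp add: set_borel_measurable_def)
    fix l :: real assume l: "l > 0"
    show "set_integrable lborel {0<..} (\<lambda>t. exp (- l * t) * u t)"
      "(LINT t:{0<..}|lborel. exp (- l * t) * u t) = 1 / \<phi> l"
      using bochner[OF l] by (simp_all only: set_integrable_def set_lebesgue_integral_def has_bochner_integral_iff)
  qed (use anti nonneg phi_pos in auto)
qed

section \<open>The Green function of the subordinate Brownian motion\<close>

lemma borel_measurable_green_profile: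
  assumes "set_borel_measurable borel {0<..} u"
  shows "green_profile d u \<in> borel_measurable borel"
proof -
  have [measurable]: "(\<lambda>t. indicator {0<..} t * u t) \<in> borel_measurable borel"
    using assms by (simp add: set_borel_measurable_def)
  have "(\<lambda>r. LINT t|lborel. (4 * pi * t) powr (- real d / 2) * exp (- r\<^sup>2 / (4 * t)) *
      (indicator {0<..} t * u t)) \<in> borel_measurable borel"
    by (rule lborel.borel_measurable_lebesgue_integral) measurable
  then show ?thesis
    by (simp add: green_profile_def[abs_def] set_lebesgue_integral_def mult_ac)
qed

text \<open>Let \<open>h s\<close> be the probability that \<open>x + B' s\<close> lies in
  \<open>A\<close>. Independence turns the occupation measure of \<open>A\<close> into the time
  integral of the mean of \<open>h (S' t \<omega>)\<close>, hence into the integral of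
  \<open>u s * h s\<close>. Writing \<open>h s\<close> with the Gaussian density and exchanging
  integrals produces the Green profile.\<close>

lemma (in prob_space) green_function_subordinate:
  fixes B :: "real \<Rightarrow> 'a \<Rightarrow> real ^ 'd"
  assumes d: "CARD('d) \<ge> 3" and "decreasing_potential u \<phi>"
    and sub: "subordinator M S" and pot: "potential_density M S u"
    and bm: "brownian_motion M B" and ind: "independent_processes M B S"
  shows "green_function M (subordinate B S) (\<lambda>x y. green_profile CARD('d) u (norm (y - x)))"
  unfolding green_function_def
proof
  fix x :: "real ^ 'd"
  interpret decreasing_potential u \<phi> by fact
  have um [measurable]: "(\<lambda>s. indicator {0<..} s * u s) \<in> borel_measurable borel"
    using meas by (simp add: set_borel_measurable_def)
  have gm [measurable]: "green_profile CARD('d) u \<in> borel_measurable borel"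
    using meas by (rule borel_measurable_green_profile)
  have g0: "0 \<le> green_profile CARD('d) u r" for r
    unfolding green_profile_def set_lebesgue_integral_def
    by (intro Bochner_Integration.integral_nonneg) (simp add: indicator_def nonneg)
  have Bl: "levy_process M B" using bm by (simp add: brownian_motion_def)
  then have Bm: "B s \<in> borel_measurable M" if "s \<ge> 0" for s
    using that by (simp add: levy_process_def)
  have Sm: "S s \<in> borel_measurable M" if "s \<ge> 0" for s
    using that sub by (simp add: subordinator_def levy_process_def)
  obtain S' where S': "(\<lambda>(t, \<omega>). S' t \<omega>) \<in> borel_measurable (borel \<Otimes>\<^sub>M M)"
      "\<And>t \<omega>. 0 \<le> S' t \<omega>" "AE \<omega> in M. \<forall>t\<ge>0. S' t \<omega> = S t \<omega>"
    by (rule subordinator_modification[OF sub], rule that)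
  obtain B' where B': "(\<lambda>(t, \<omega>). B' t \<omega>) \<in> borel_measurable (borel \<Otimes>\<^sub>M M)"
      "AE \<omega> in M. \<forall>t\<ge>0. B' t \<omega> = B t \<omega>"
      "\<And>t \<omega>. t \<ge> 0 \<Longrightarrow> ((\<lambda>s. B' s \<omega>) \<longlongrightarrow> B' t \<omega>) (at_right t)"
    by (rule levy_process_modification[OF Bl], rule that)
  have S'm [measurable]: "(\<lambda>\<omega>. S' t \<omega>) \<in> borel_measurable M" for t
    using measurable_compose[OF measurable_Pair1' S'(1), of t] by simp
  have B'm [measurable]: "(\<lambda>\<omega>. B' t \<omega>) \<in> borel_measurable M" for t
    using measurable_compose[OF measurable_Pair1' B'(1), of t] by simp
  have Bc: "(\<lambda>y. B' (f y) (g y)) \<in> borel_measurable N"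
    if "f \<in> borel_measurable N" "g \<in> measurable N M" for f g and N :: "'c measure"
    using measurable_compose[OF measurable_Pair[OF that] B'(1)] by simp
  \<comment> \<open>Independence of the two families of events is needed only for one fixed time of
    each process, and it passes to the modifications because they agree almost surely.\<close>
  have indep: "prob {\<omega> \<in> space M. B' s \<omega> \<in> A \<and> S' t \<omega> \<in> C}
      = prob {\<omega> \<in> space M. B' s \<omega> \<in> A} * prob {\<omega> \<in> space M. S' t \<omega> \<in> C}"
    if st: "s \<ge> 0" "t \<ge> 0" and AC [measurable]: "A \<in> sets borel" "C \<in> sets borel" for s t A C
  proof -
    note [measurable] = Bm[OF st(1)] Sm[OF st(2)]
    have "B s -` A \<inter> space M \<in> process_events M B" "S t -` C \<inter> space M \<in> process_events M S"
      unfolding process_events_def using st AC by (blast intro: sigma_sets.Basic)+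
    then have *: "prob ((B s -` A \<inter> space M) \<inter> (S t -` C \<inter> space M))
        = prob (B s -` A \<inter> space M) * prob (S t -` C \<inter> space M)"
      using ind by (intro indep_setD) (auto simp: independent_processes_def)
    have AE: "AE \<omega> in M. B' s \<omega> = B s \<omega> \<and> S' t \<omega> = S t \<omega>"
      using B'(2) S'(3) by eventually_elim (use st in simp)
    have "prob {\<omega> \<in> space M. B' s \<omega> \<in> A \<and> S' t \<omega> \<in> C}
        = prob ((B s -` A \<inter> space M) \<inter> (S t -` C \<inter> space M))"
      by (rule finite_measure_eq_AE, use AE in eventually_elim) auto
    moreover have "prob {\<omega> \<in> space M. B' s \<omega> \<in> A} = prob (B s -` A \<inter> space M)"
      by (rule finite_measure_eq_AE, use AE in eventually_elim) auto
    moreover have "prob {\<omega> \<in> space M. S' t \<omega> \<in> C} = prob (S t -` C \<inter> space M)"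
      by (rule finite_measure_eq_AE, use AE in eventually_elim) auto
    ultimately show ?thesis using * by simp
  qed
  have comp: "(\<integral>\<^sup>+\<omega>. F (B' (S' t \<omega>) \<omega>) \<partial>M) = (\<integral>\<^sup>+\<omega>. (\<integral>\<^sup>+\<omega>'. F (B' (S' t \<omega>) \<omega>') \<partial>M) \<partial>M)"
    if t: "t \<ge> 0" and F [measurable]: "F \<in> borel_measurable borel"
    for t and F :: "real ^ 'd \<Rightarrow> ennreal"
  proof -
    have [measurable]: "(\<lambda>\<omega>. B' (S' t \<omega>) \<omega>) \<in> borel_measurable M"
      "(\<lambda>p. B' (S' t (fst p)) (snd p)) \<in> borel_measurable (M \<Otimes>\<^sub>M M)"
      by (rule Bc; measurable)+
    have "(\<integral>\<^sup>+\<omega>. F (B' (S' t \<omega>) \<omega>) \<partial>M) = (\<integral>\<^sup>+y. F y \<partial>distr M borel (\<lambda>\<omega>. B' (S' t \<omega>) \<omega>))"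
      by (subst nn_integral_distr) simp_all
    also have "distr M borel (\<lambda>\<omega>. B' (S' t \<omega>) \<omega>)
        = distr (M \<Otimes>\<^sub>M M) borel (\<lambda>p. B' (S' t (fst p)) (snd p))"
      using B'(1,3) S'(2) indep t by (intro distr_composition_independent S'm) auto
    also have "(\<integral>\<^sup>+y. F y \<partial>\<dots>) = (\<integral>\<^sup>+p. F (B' (S' t (fst p)) (snd p)) \<partial>(M \<Otimes>\<^sub>M M))"
      by (subst nn_integral_distr) simp_all
    also have "\<dots> = (\<integral>\<^sup>+\<omega>. (\<integral>\<^sup>+\<omega>'. F (B' (S' t \<omega>) \<omega>') \<partial>M) \<partial>M)"
      by (subst nn_integral_fst[symmetric]) simp_all
    finally show ?thesis .
  qed
  define X' where "X' t \<omega> = x + B' (S' t \<omega>) \<omega>" for t \<omega>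
  have X'm: "(\<lambda>(t, \<omega>). X' t \<omega>) \<in> borel_measurable (borel \<Otimes>\<^sub>M M)"
  proof -
    have "(\<lambda>p. S' (fst p) (snd p)) \<in> borel_measurable (borel \<Otimes>\<^sub>M M)"
      using S'(1) by (simp add: case_prod_unfold)
    then have "(\<lambda>p. B' (S' (fst p) (snd p)) (snd p)) \<in> borel_measurable (borel \<Otimes>\<^sub>M M)"
      by (rule Bc) measurable
    then show ?thesis unfolding X'_def case_prod_unfold by measurable
  qed
  have X'eq: "AE \<omega> in M. \<forall>t\<ge>0. X' t \<omega> = x + subordinate B S t \<omega>"
    using S'(3) B'(2)
  proof eventually_elim
    case (elim \<omega>)
    show ?case
    proof (intro allI impI)
      fix t :: real assume "t \<ge> 0"
      then have "S' t \<omega> = S t \<omega>" using elim by blast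
      moreover have "B' (S' t \<omega>) \<omega> = B (S' t \<omega>) \<omega>" using elim S'(2) by blast
      ultimately show "X' t \<omega> = x + subordinate B S t \<omega>" by (simp add: X'_def subordinate_def)
    qed
  qed
  have "occupation_measure M (\<lambda>t \<omega>. x + subordinate B S t \<omega>) A
      = (\<integral>\<^sup>+y\<in>A. ennreal (green_profile CARD('d) u (norm (y - x))) \<partial>lborel)"
    if A [measurable]: "A \<in> sets borel" for A
  proof -
    define h where "h s = (\<integral>\<^sup>+\<omega>. indicator A (x + B' s \<omega>) \<partial>M)" for s
    define K where "K s y = bm_transition_density s 0 (y - x)" for s and y :: "real ^ 'd"
    have K0: "0 \<le> K s y" for s y by (simp add: K_def bm_transition_density_def)
    have Km [measurable]: "(\<lambda>p. K (fst p) (snd p)) \<in> borel_measurable (lborel \<Otimes>\<^sub>M lborel)"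
      unfolding K_def bm_transition_density_def by measurable
    have Ks [measurable]: "K s \<in> borel_measurable borel" for s
      unfolding K_def bm_transition_density_def by measurable
    have hm [measurable]: "h \<in> borel_measurable borel"
    proof -
      have "(\<lambda>p. B' (fst p) (snd p)) \<in> borel_measurable (borel \<Otimes>\<^sub>M M)"
        using B'(1) by (simp add: case_prod_unfold)
      then have "(\<lambda>p. indicator A (x + B' (fst p) (snd p)) :: ennreal) \<in> borel_measurable (borel \<Otimes>\<^sub>M M)"
        by measurable
      from borel_measurable_nn_integral_fst[OF this] show ?thesis
        by (simp add: h_def[abs_def])
    qed
    \<comment> \<open>Restricted to \<open>s > 0\<close>, where \<open>B s\<close> has a density.
      The weight \<open>indicator {0<..} s * u s\<close> removes the remaining
      \<open>s\<close>.\<close>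
    have hK: "h s = (\<integral>\<^sup>+y. ennreal (K s y) * indicator A y \<partial>lborel)" if s: "s > 0" for s
    proof -
      have "h s = (\<integral>\<^sup>+\<omega>. indicator A (x + B s \<omega>) \<partial>M)"
        unfolding h_def
        by (rule nn_integral_cong_AE, use B'(2) in eventually_elim) (use s in simp)
      also have "\<dots> = (\<integral>\<^sup>+y. ennreal (bm_transition_density s 0 y) * indicator A (x + y) \<partial>lborel)"
        using bm s by (intro distributed_nn_integral[symmetric, of M lborel "B s"])
          (auto simp: brownian_motion_def)
      also have "\<dots> = (\<integral>\<^sup>+y. ennreal (K s (x + y)) * indicator A (x + y) \<partial>lborel)"
        by (simp add: K_def)
      also have "\<dots> = (\<integral>\<^sup>+y. ennreal (K s y) * indicator A y \<partial>distr lborel borel ((+) x))"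
        by (subst nn_integral_distr) simp_all
      also have "distr lborel borel ((+) x) = lborel" by (rule lborel_distr_plus)
      finally show ?thesis .
    qed
    have "occupation_measure M (\<lambda>t \<omega>. x + subordinate B S t \<omega>) A
        = (\<integral>\<^sup>+t\<in>{0..}. (\<integral>\<^sup>+\<omega>. indicator A (X' t \<omega>) \<partial>M) \<partial>lborel)"
      by (rule occupation_measure_eq[OF X'm X'eq A])
    also have "\<dots> = (\<integral>\<^sup>+t\<in>{0..}. (\<integral>\<^sup>+\<omega>. h (S' t \<omega>) \<partial>M) \<partial>lborel)"
    proof (intro nn_integral_cong)
      fix t :: real
      show "(\<integral>\<^sup>+\<omega>. indicator A (X' t \<omega>) \<partial>M) * indicator {0..} t
          = (\<integral>\<^sup>+\<omega>. h (S' t \<omega>) \<partial>M) * indicator {0..} t"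
      proof (cases "t \<ge> 0")
        case True
        then show ?thesis
          using comp[of t "\<lambda>y. indicator A (x + y)"] by (simp add: X'_def h_def)
      qed simp
    qed
    also have "\<dots> = (\<integral>\<^sup>+s. ennreal (indicator {0<..} s * u s) * h s \<partial>lborel)"
      by (rule nn_integral_potential[OF S' pot hm])
    also have "\<dots> = (\<integral>\<^sup>+s. (\<integral>\<^sup>+y. ennreal (indicator {0<..} s * u s) * (ennreal (K s y) * indicator A y) \<partial>lborel) \<partial>lborel)"
    proof (intro nn_integral_cong)
      fix s :: real
      show "ennreal (indicator {0<..} s * u s) * h s
          = (\<integral>\<^sup>+y. ennreal (indicator {0<..} s * u s) * (ennreal (K s y) * indicator A y) \<partial>lborel)"
      proof (cases "s > 0")
        case True
        then show ?thesis by (subst nn_integral_cmult) (simp_all add: hK)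
      qed simp
    qed
    also have "\<dots> = (\<integral>\<^sup>+y. (\<integral>\<^sup>+s. ennreal (indicator {0<..} s * u s) * (ennreal (K s y) * indicator A y) \<partial>lborel) \<partial>lborel)"
      using lborel_pair.Fubini[of "\<lambda>p. ennreal (indicator {0<..} (fst p) * u (fst p)) *
        (ennreal (K (fst p) (snd p)) * indicator A (snd p))"] by simp
    also have "\<dots> = (\<integral>\<^sup>+y\<in>A. ennreal (green_profile CARD('d) u (norm (y - x))) \<partial>lborel)"
    proof (rule nn_integral_cong_AE)
      \<comment> \<open>On the diagonal the radius is 0 and \<open>green_integral\<close> does not
        apply; a single point is Lebesgue null.\<close>
      have "AE y in lborel. y \<noteq> x" by (rule AE_lborel_singleton)
      then show "AE y in lborel. (\<integral>\<^sup>+s. ennreal (indicator {0<..} s * u s) * (ennreal (K s y) * indicator A y) \<partial>lborel)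
          = ennreal (green_profile CARD('d) u (norm (y - x))) * indicator A y"
      proof eventually_elim
        case (elim y)
        let ?r = "norm (y - x)"
        let ?k = "\<lambda>s. (4 * pi * s) powr (- real CARD('d) / 2) * exp (- ?r\<^sup>2 / (4 * s))"
        have r: "?r > 0" using elim by simp
        have Kk: "K s y = ?k s" for s
          by (simp add: K_def bm_transition_density_def norm_minus_commute)
        have int: "integrable lborel (\<lambda>s. indicator {0<..} s *\<^sub>R (?k s * u s))"
          using green_integral(1)[OF d r] by (simp add: set_integrable_def)
        have "(\<integral>\<^sup>+s. ennreal (indicator {0<..} s * u s) * (ennreal (K s y) * indicator A y) \<partial>lborel)
            = (\<integral>\<^sup>+s. ennreal (indicator {0<..} s *\<^sub>R (?k s * u s)) * indicator A y \<partial>lborel)"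
        proof (intro nn_integral_cong)
          fix s :: real
          have "ennreal (u s) * ennreal (?k s) = ennreal (?k s * u s)" if "s > 0"
            using nonneg[OF that] by (subst mult.commute, subst ennreal_mult) simp_all
          then show "ennreal (indicator {0<..} s * u s) * (ennreal (K s y) * indicator A y)
              = ennreal (indicator {0<..} s *\<^sub>R (?k s * u s)) * indicator A y"
            unfolding Kk by (cases "s > 0") (simp_all add: mult.assoc[symmetric])
        qed
        also have "\<dots> = (\<integral>\<^sup>+s. ennreal (indicator {0<..} s *\<^sub>R (?k s * u s)) \<partial>lborel) * indicator A y"
          by (intro nn_integral_multc measurable_compose[OF borel_measurable_integrable[OF int] measurable_ennreal])
        also have "(\<integral>\<^sup>+s. ennreal (indicator {0<..} s *\<^sub>R (?k s * u s)) \<partial>lborel)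
            = ennreal (green_profile CARD('d) u ?r)"
          unfolding green_profile_def set_lebesgue_integral_def
          using nonneg by (intro nn_integral_eq_integral int AE_I2) (simp add: indicator_def)
        finally show ?case .
      qed
    qed
    finally show ?thesis .
  qed
  moreover have "(\<lambda>y. green_profile CARD('d) u (norm (y - x))) \<in> borel_measurable borel"
    by measurable
  ultimately show "has_occupation_density M (\<lambda>t \<omega>. x + subordinate B S t \<omega>) UNIV
      (\<lambda>y. green_profile CARD('d) u (norm (y - x)))"
    using g0 by (simp add: has_occupation_density_def set_borel_measurable_def)
qed

theorem theorem4p2:
  fixes M :: "'a measure"
    and S :: "real \<Rightarrow> 'a \<Rightarrow> real"
    and B :: "real \<Rightarrow> 'a \<Rightarrow> real ^ 'd"
    and \<phi> u :: "real \<Rightarrow> real"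
    and \<alpha> :: real
  assumes "CARD('d) \<ge> 3"
    and "subordinator M S"
    and "laplace_exponent M S \<phi>"
    and "\<alpha> \<in> {0..2}"
    and "\<And>x::real. x > 0 \<Longrightarrow>
           ((\<lambda>l. deriv \<phi> (l * x) / deriv \<phi> l) \<longlongrightarrow> x powr (\<alpha> / 2 - 1)) at_top"
    and "potential_density M S u"
    and "antimono_on {0<..} u"
    and "brownian_motion M B"
    and "independent_processes M B S"
  shows "let d = real CARD('d); g = green_profile CARD('d) u in
     green_function M (subordinate B S) (\<lambda>x y. g (norm (y - x))) \<and>
     (\<alpha> < 2 \<longrightarrow>
        comparable_at_0 g
          (\<lambda>r. r powr (- d - 2) * (deriv \<phi> (r powr -2) / (\<phi> (r powr -2))\<^sup>2))) \<and>
     (\<alpha> = 2 \<longrightarrow>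
        comparable_at_0 g (\<lambda>r. r powr (- d + 2) * (1 / deriv \<phi> (r powr -2))) \<and>
        comparable_at_0 (\<lambda>r. r powr (- d + 2) * (1 / deriv \<phi> (r powr -2)))
          (\<lambda>r. r powr (- d) * (1 / \<phi> (r powr -2))))"
proof -
  interpret prob_space M
    using assms(2) by (simp add: subordinator_def levy_process_def)
  have dp: "decreasing_potential u \<phi>"
    by (rule decreasing_potential_of_subordinator[OF assms(2,3,6,7)])
  then interpret decreasing_potential u \<phi> .
  \<comment> \<open>For \<open>\<alpha> = 2\<close> the exponent \<open>\<alpha> / 2 - 1\<close> is
    0, so the limit at \<open>x = 1 / 2\<close> is 1.\<close>
  have ratio: "((\<lambda>l. deriv \<phi> (l * (1 / 2)) / deriv \<phi> l) \<longlongrightarrow> 1) at_top" if "\<alpha> = 2"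
    using assms(5)[of "1 / 2"] that by simp
  note two = green_profile_asymp_two[OF assms(1) ratio]
  show ?thesis
    unfolding Let_def
    by (intro conjI impI green_function_subordinate[OF assms(1) dp assms(2,6,8,9)]
        green_profile_asymp[OF assms(1) _ assms(5)] two)
qed

end
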